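(* Let $\Lambda\subset\mathbb{Z}$, let $(c_j)_{j\in\Lambda}$ be a square-summable family of complex numbers, let $0<T\le\frac12$, and let $u(t)=\sum_{j\in\Lambda}c_j\,\chi_{[0,T]+j}(t)$. If $\Lambda$ is a $B_2$-set, then for all real numbers $\omega_j$ ($j\in\Lambda$), the function $$v(t)=\sum_{j\in\Lambda}e^{i\omega_j}c_j\,\chi_{[0,T]+j}(t)$$ is a partner of $u$. Moreover, if $\Lambda$ is a finite $B_3$-set, these are all partners of $u$.
   Context: For $u\in L^2(\mathbb{R})$ put $A(u)(x,y)=\int_{\mathbb{R}}u(t)\overline{u(t-x)}e^{iyt}\,dt$, $x,y\in\mathbb{R}$. Functions $u,v\in L^2(\mathbb{R})$ are (ambiguity) partners if $|A(u)(x,y)|=|A(v)(x,y)|$ for all $x,y\in\mathbb{R}$. A set $\Lambda\subset\mathbb{Z}$ is a $B_2$-set if every $n\in\Lambda+\Lambda$ can be written uniquely, up to permutation, as $n=n_1+n_2$ with $n_1,n_2\in\Lambda$. It is a $B_3$-set if every $n\in\Lambda+\Lambda+\Lambda$ can be written uniquely, up to permutation, as $n=n_1+n_2+n_3$ with $n_1,n_2,n_3\in\Lambda$. $\chi_E$ is the characteristic function of $E$.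
   Formalization: "These are all partners of u" is read up to translation, reflection, modulation and unimodular constants (and equality a.e.): these always preserve |A(u)|, so the literal claim fails, e.g. for Λ={0}, where u(t-1) is a partner of u. *)

theory Defs
  imports "HOL-Analysis.Analysis" "HOL-Library.Multiset" "HOL-Library.Set_Algebras"
begin

text \<open>
  Elements of \<open>L\<^sup>2(\<real>)\<close> are represented by Borel functions; classes are not formed, so equality in
  \<open>L\<^sup>2(\<real>)\<close> is almost-everywhere equality.
\<close>

definition L2 :: "(real \<Rightarrow> complex) set" where
  "L2 = {u \<in> borel_measurable lborel. integrable lborel (\<lambda>t. (cmod (u t))\<^sup>2)}"

definition ambiguity :: "(real \<Rightarrow> complex) \<Rightarrow> real \<Rightarrow> real \<Rightarrow> complex" where
  "ambiguity u x y = (LINT t|lborel. u t * cnj (u (t - x)) * cis (y * t))"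

definition ambiguity_partners :: "(real \<Rightarrow> complex) \<Rightarrow> (real \<Rightarrow> complex) \<Rightarrow> bool" where
  "ambiguity_partners u v \<longleftrightarrow>
     u \<in> L2 \<and> v \<in> L2 \<and> (\<forall>x y. cmod (ambiguity u x y) = cmod (ambiguity v x y))"

text \<open>
  Time shift, reflection, modulation and multiplication by a unimodular constant leave
  \<open>\<bar>A(u)\<bar>\<close> unchanged for every \<open>u\<close>; \<open>v\<close> is a trivial transform of \<open>u\<close> if it arises from \<open>u\<close> by these.
\<close>

definition trivial_transform :: "(real \<Rightarrow> complex) \<Rightarrow> (real \<Rightarrow> complex) \<Rightarrow> bool" where
  "trivial_transform u v \<longleftrightarrow>
     (\<exists>\<epsilon>\<in>{-1, 1}. \<exists>a b \<theta>. AE t in lborel. v t = cis (\<theta> + b * t) * u (\<epsilon> * t - a))"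

text \<open>Uniqueness up to permutation is uniqueness of the multiset of summands.\<close>

definition B2_set :: "int set \<Rightarrow> bool" where
  "B2_set \<Lambda> \<longleftrightarrow>
     (\<forall>n\<in>\<Lambda> + \<Lambda>. \<exists>!M. \<exists>n1\<in>\<Lambda>. \<exists>n2\<in>\<Lambda>. M = {#n1, n2#} \<and> n = n1 + n2)"

definition B3_set :: "int set \<Rightarrow> bool" where
  "B3_set \<Lambda> \<longleftrightarrow>
     (\<forall>n\<in>\<Lambda> + \<Lambda> + \<Lambda>. \<exists>!M. \<exists>n1\<in>\<Lambda>. \<exists>n2\<in>\<Lambda>. \<exists>n3\<in>\<Lambda>. M = {#n1, n2, n3#} \<and> n = n1 + n2 + n3)"

text \<open>
  For \<open>T < 1\<close> the intervals are disjoint, so at each \<open>t\<close> at most one summand is nonzero and the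
  unconditional sum always exists.
\<close>

definition pulse_signal :: "int set \<Rightarrow> real \<Rightarrow> (int \<Rightarrow> complex) \<Rightarrow> real \<Rightarrow> complex" where
  "pulse_signal \<Lambda> T c t =
     (\<Sum>\<^sub>\<infinity>j\<in>\<Lambda>. c j * indicator {real_of_int j..real_of_int j + T} t)"

end

theory Submission
  imports Defs
begin

text \<open>
  For fixed \<open>x\<close> the function \<open>A(v)(x, \<cdot>)\<close> is the Fourier transform of \<open>V\<^sub>x(t) = v(t) cnj (v(t - x))\<close>, and
  likewise for \<open>u\<close> and \<open>U\<^sub>x\<close>. Two facts carry information from \<open>\<bar>A(u)\<bar>\<close> to a partner \<open>v\<close>: if \<open>U\<^sub>x = 0\<close> then \<open>V\<^sub>x = 0\<close>, and if \<open>U\<^sub>x\<close> is constant on an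
  interval containing the support of \<open>V\<^sub>x\<close> and vanishes off it, then \<open>V\<^sub>x\<close> is constant there as well, because
  its nonzero Fourier coefficients on that interval vanish.

  Let \<open>m\<close> and \<open>M\<close> be the extreme elements of \<open>\<Lambda>\<close>. For \<open>x > M - m + T\<close> the first fact confines \<open>v\<close>, after a
  translation, to \<open>[m, M + T]\<close>. For \<open>x = M - m + s\<close> with \<open>0 \<le> s < T\<close> the second one makes \<open>v\<close> an exponential on the
  two extreme pulses, and a modulation makes it constant there. Pairing any other part of \<open>v\<close> with the
  extreme pulses, the \<open>B\<^sub>3\<close> property shows that \<open>v\<close> lives on the pulses at \<open>\<Lambda>\<close> or on those at \<open>m + M - \<Lambda>\<close>; a
  reflection leads to the former case. Then \<open>x = k - m\<close> shows that \<open>v\<close> is constant on the \<open>k\<close>-th pulse, and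
  \<open>x = j - k\<close> together with the energy determines the moduli of the constants.
\<close>

section \<open>Uniqueness of Fourier coefficients and Fourier transforms\<close>

text \<open>The partner condition forgets the phase of every Fourier transform. What survives is the
  location of its zeros and, at \<open>y = 0\<close>, a size; both transfer facts use nothing else.
  Each relation so obtained for \<open>v\<close> holds for one shift \<open>x\<close> outside a null
  set depending on \<open>x\<close>, so a continuum of shifts cannot be combined pointwise.
  Tonelli's theorem, countable families of windows, and Fourier coefficients over windows get around
  this. The bound \<open>T \<le> 1 / 2\<close> separates differences: pulses \<open>j\<close> and
  \<open>k\<close> overlap in positive measure only if \<open>x\<close> is closer than
  \<open>T\<close> to \<open>j - k\<close>, so one \<open>x\<close> sees at most one integer
  difference. The \<open>B\<^sub>3\<close> property enters where two positions are compared through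
  both extremes \<open>m\<close> and \<open>M\<close>, which produces equations between sums of
  three elements. The values of \<open>v\<close> on the extreme pulses have to be divided out, so
  \<open>m\<close> and \<open>M\<close> must carry nonzero coefficients; indices with coefficient
  zero are removed beforehand.\<close>

lemma AE_lborel_affine:
  fixes c :: real
  assumes "AE x in lborel. P x" "c \<noteq> 0"
  shows "AE x in lborel. P (t + c * x)"
proof -
  obtain N where N: "N \<in> null_sets lborel" "{x. \<not> P x} \<subseteq> N"
    using assms(1) by (auto simp: eventually_ae_filter)
  have "AE x in lborel. x \<notin> N" using N(1) by (rule AE_not_in)
  moreover have "Measurable.pred borel (\<lambda>x. x \<notin> N)" using N(1) by auto
  ultimately have "AE x in lborel. t + c * x \<notin> N"
    using AE_borel_affine[OF assms(2), of "\<lambda>x. x \<notin> N" t] by simp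
  then show ?thesis by eventually_elim (use N(2) in auto)
qed

lemma borel_measurable_cis [measurable]: "cis \<in> borel_measurable borel"
  by (intro borel_measurable_continuous_onI continuous_intros)

text \<open>Open intervals are stable under intersection and generate the Borel sets, so a Dynkin
  argument carries the vanishing from intervals to all Borel sets, and a density with all integrals
  zero is zero.\<close>

lemma AE_zero_if_interval_integrals_zero:
  fixes f :: "real \<Rightarrow> complex"
  assumes f: "integrable lborel f"
    and z: "\<And>a b. (LINT t|lborel. indicator {a<..<b} t *\<^sub>R f t) = 0"
  shows "AE t in lborel. f t = 0"
proof -
  \<comment> \<open>The complement case of the induction needs the integral over the whole line,
    which is obtained as a limit over bounded intervals.\<close>
  have UNIV: "(LINT t|lborel. f t) = 0"
  proof -
    have "(\<lambda>n. LINT t|lborel. indicator {- real n<..<real n} t *\<^sub>R f t) \<longlonglongrightarrow> (LINT t|lborel. f t)"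
    proof (rule integral_dominated_convergence[where w = "\<lambda>t. norm (f t)"])
      show "AE t in lborel. (\<lambda>n. indicat_real {- real n<..<real n} t *\<^sub>R f t) \<longlonglongrightarrow> f t"
      proof (rule AE_I2)
        fix t :: real
        have "eventually (\<lambda>n. real n > \<bar>t\<bar>) sequentially"
          using filterlim_real_sequentially by (simp add: filterlim_at_top_dense)
        then have "eventually (\<lambda>n. indicat_real {- real n<..<real n} t *\<^sub>R f t = f t) sequentially"
          by eventually_elim (auto simp: indicator_def)
        then show "(\<lambda>n. indicat_real {- real n<..<real n} t *\<^sub>R f t) \<longlonglongrightarrow> f t"
          by (rule tendsto_eventually)
      qed
    qed (use f in \<open>auto simp: indicator_def\<close>)
    then show ?thesis unfolding z using LIMSEQ_unique tendsto_const by blast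
  qed
  have "set_lebesgue_integral lborel A f = 0" if "A \<in> sets borel" for A
  proof -
    let ?G = "range (\<lambda>(a, b). {a <..< b :: real})"
    have int: "set_integrable lborel B f" if "B \<in> sets borel" for B
      using f that unfolding set_integrable_def by (intro integrable_mult_indicator) auto
    have sg: "sigma_sets UNIV ?G = sets borel"
      unfolding borel_eq_box box_real by (simp add: sets_measure_of)
    have "Int_stable ?G"
    proof (rule Int_stableI)
      fix a b assume "a \<in> ?G" "b \<in> ?G"
      then obtain p q r s where "a = {p<..<q}" "b = {r<..<s}" by auto
      then have "a \<inter> b = {max p r<..<min q s}" by auto
      then show "a \<inter> b \<in> ?G" by auto
    qed
    moreover have "?G \<subseteq> Pow UNIV" by auto
    moreover have "A \<in> sigma_sets UNIV ?G" using that sg by simp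
    ultimately show ?thesis
    proof (induction rule: sigma_sets_induct_disjoint)
      case (basic A)
      then show ?case using z by (auto simp: set_lebesgue_integral_def)
    next
      case empty then show ?case by (simp add: set_lebesgue_integral_def)
    next
      case (compl A)
      then have [measurable]: "A \<in> sets borel" by (simp add: sg)
      have "(LINT t|lborel. f t) = set_lebesgue_integral lborel (A \<union> (UNIV - A)) f"
        by (simp add: set_lebesgue_integral_def)
      also have "\<dots> = set_lebesgue_integral lborel A f + set_lebesgue_integral lborel (UNIV - A) f"
        by (rule set_integral_Un) (auto intro!: int)
      finally show ?case using compl UNIV by simp
    next
      case (union A)
      then have A: "A i \<in> sets borel" for i by (auto simp: sg)
      have "set_lebesgue_integral lborel (\<Union> (range A)) f = (\<Sum>i. set_lebesgue_integral lborel (A i) f)"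
        using A union by (intro lebesgue_integral_countable_add int) (auto simp: disjoint_family_on_def)
      then show ?case using union by simp
    qed
  qed
  then show ?thesis using sigma_finite_measure.density_zero[OF sigma_finite_lborel f] by simp
qed

text \<open>Induction on \<open>g\<close>: since \<open>f\<close> is arbitrary, the case of a product is the composition of two instances.\<close>

lemma vanishing_fourier_times_polynomial:
  fixes f :: "real \<Rightarrow> complex"
  assumes "real_polynomial_function g" "integrable lborel f"
    "\<And>k::int. (LINT t|lborel. f t * cis (of_int k * (\<omega> * t))) = 0"
  shows "integrable lborel (\<lambda>t. f t * of_real (g (cis (\<omega> * t)))) \<and>
    (\<forall>k::int. (LINT t|lborel. f t * of_real (g (cis (\<omega> * t))) * cis (of_int k * (\<omega> * t))) = 0)"
  using assms
proof (induction arbitrary: f)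
  case (linear g)
  have [measurable]: "f \<in> borel_measurable borel" using linear by auto
  note f_int = linear(2) and f_zero = linear(3)
  interpret bounded_linear g by fact
  have int: "integrable lborel (\<lambda>t. f t * cis (of_int k * (\<omega> * t)))" for k :: int
    by (rule Bochner_Integration.integrable_bound[OF f_int]) (auto simp: norm_mult)
  \<comment> \<open>A real-linear form of \<open>cis \<theta>\<close> combines its cosine and sine;
    \<open>A\<close> and \<open>B\<close> are its coefficients with respect to
    \<open>cis \<theta>\<close> and \<open>cis (- \<theta>)\<close>. Multiplication by it therefore
    only moves the frequency index to \<open>k + 1\<close> and \<open>k - 1\<close>.\<close>
  define A B :: complex where "A = (of_real (g 1) - \<i> * of_real (g \<i>)) / 2"
    and "B = (of_real (g 1) + \<i> * of_real (g \<i>)) / 2"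
  have g: "of_real (g (cis \<theta>)) = A * cis \<theta> + B * cis (-\<theta>)" for \<theta>
  proof -
    have "cis \<theta> = cos \<theta> *\<^sub>R 1 + sin \<theta> *\<^sub>R \<i>" by (simp add: complex_eq_iff)
    then have "g (cis \<theta>) = cos \<theta> * g 1 + sin \<theta> * g \<i>"
      by (metis add scaleR real_scaleR_def)
    then show ?thesis by (simp add: complex_eq_iff A_def B_def field_simps)
  qed
  have eq: "f t * of_real (g (cis (\<omega> * t))) * cis (of_int k * (\<omega> * t))
      = A * (f t * cis (of_int (k + 1) * (\<omega> * t))) + B * (f t * cis (of_int (k - 1) * (\<omega> * t)))" for t k
  proof -
    have "cis (of_int (k + 1) * (\<omega> * t)) = cis (\<omega> * t) * cis (of_int k * (\<omega> * t))"
      "cis (of_int (k - 1) * (\<omega> * t)) = cis (- (\<omega> * t)) * cis (of_int k * (\<omega> * t))"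
      by (simp_all add: cis_mult algebra_simps)
    then show ?thesis unfolding g by (simp add: algebra_simps)
  qed
  have "integrable lborel (\<lambda>t. A * (f t * cis (of_int (k + 1) * (\<omega> * t))) + B * (f t * cis (of_int (k - 1) * (\<omega> * t))))" for k
    using int[of "k+1"] int[of "k-1"] by auto
  then have "integrable lborel (\<lambda>t. f t * of_real (g (cis (\<omega> * t))) * cis (of_int k * (\<omega> * t)))" for k
    unfolding eq .
  from this[of 0] have "integrable lborel (\<lambda>t. f t * of_real (g (cis (\<omega> * t))))" by simp
  moreover have "(LINT t|lborel. f t * of_real (g (cis (\<omega> * t))) * cis (of_int k * (\<omega> * t))) = 0" for k
    unfolding eq using int[of "k+1"] int[of "k-1"] by (subst Bochner_Integration.integral_add) (auto simp del: of_int_add of_int_diff simp: f_zero)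
  ultimately show ?case by blast
next
  case (const c)
  then have "(LINT t|lborel. c * (f t * cis (of_int k * (\<omega> * t)))) = 0" for k
    by simp
  then show ?case using const by (simp add: mult_ac)
next
  case (add g h)
  have [measurable]: "f \<in> borel_measurable borel" using add by auto
  have g: "integrable lborel (\<lambda>t. f t * of_real (g (cis (\<omega> * t))))"
    "(LINT t|lborel. f t * of_real (g (cis (\<omega> * t))) * cis (of_int k * (\<omega> * t))) = 0"
    and h: "integrable lborel (\<lambda>t. f t * of_real (h (cis (\<omega> * t))))"
    "(LINT t|lborel. f t * of_real (h (cis (\<omega> * t))) * cis (of_int k * (\<omega> * t))) = 0" for k
    using add by auto
  have int: "integrable lborel (\<lambda>t. F t * cis (of_int k * (\<omega> * t)))" if "integrable lborel F" for k :: int and F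
    using borel_measurable_integrable[OF that]
    by (intro Bochner_Integration.integrable_bound[OF that]) (auto simp: norm_mult)
  show ?case using g h int[OF g(1)] int[OF h(1)] by (auto simp: algebra_simps)
next
  case (mult g h)
  show ?case using mult(4)[of "\<lambda>t. f t * of_real (g (cis (\<omega> * t)))"] mult(3)[OF mult(5,6)]
    by (simp add: mult.assoc)
qed

text \<open>By Stone-Weierstrass on the unit circle, \<open>\<phi>\<close> is within any
  \<open>e > 0\<close> of a polynomial whose integral against \<open>f\<close> vanishes; the error
  is at most \<open>e\<close> times the integral of \<open>norm (f t)\<close>.\<close>

lemma vanishing_fourier_times_continuous:
  fixes f :: "real \<Rightarrow> complex" and \<phi> :: "complex \<Rightarrow> real"
  assumes f: "integrable lborel f"
    and z: "\<And>k::int. (LINT t|lborel. f t * cis (of_int k * (\<omega> * t))) = 0"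
    and \<phi>: "continuous_on UNIV \<phi>"
  shows "(LINT t|lborel. f t * of_real (\<phi> (cis (\<omega> * t)))) = 0"
proof -
  have [measurable]: "f \<in> borel_measurable borel" "\<phi> \<in> borel_measurable borel"
    using f \<phi> by (auto intro: borel_measurable_continuous_onI)
  have c1: "compact (sphere (0::complex) 1)" by simp
  have "\<exists>B. \<forall>z\<in>sphere 0 1. norm (\<phi> z) \<le> B"
    using compact_imp_bounded[OF compact_continuous_image[OF _ c1]] continuous_on_subset[OF \<phi>]
    by (force simp: bounded_iff)
  then obtain B where B: "\<And>z. z \<in> sphere 0 1 \<Longrightarrow> norm (\<phi> z) \<le> B" by blast
  have int: "integrable lborel (\<lambda>t. f t * of_real (\<phi> (cis (\<omega> * t))))"
  proof (rule Bochner_Integration.integrable_bound)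
    show "integrable lborel (\<lambda>t. norm (f t) * B)" using f by simp
    have "norm (f t) * \<bar>\<phi> (cis (\<omega> * t))\<bar> \<le> \<bar>norm (f t) * B\<bar>" for t
    proof -
      have "\<bar>\<phi> (cis (\<omega> * t))\<bar> \<le> \<bar>B\<bar>" using B[of "cis (\<omega> * t)"] by simp
      then show ?thesis unfolding abs_mult by (intro mult_mono) auto
    qed
    then show "AE x in lborel. norm (f x * of_real (\<phi> (cis (\<omega> * x)))) \<le> norm (norm (f x) * B)"
      by (auto simp: norm_mult)
  qed auto
  have "norm (LINT t|lborel. f t * of_real (\<phi> (cis (\<omega> * t)))) \<le> e * (LINT t|lborel. norm (f t))" if e: "e > 0" for e
  proof -
    obtain g where g: "real_polynomial_function g" "\<And>x. x \<in> sphere 0 1 \<Longrightarrow> \<bar>\<phi> x - g x\<bar> < e"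
      using Stone_Weierstrass_real_polynomial_function[OF c1 _ e] continuous_on_subset[OF \<phi>] by blast
    note G = vanishing_fourier_times_polynomial[OF g(1) f z]
    have "(LINT t|lborel. f t * of_real (g (cis (\<omega> * t)))) = 0"
      using spec[OF conjunct2[OF G], of 0] by simp
    then have "(LINT t|lborel. f t * of_real (\<phi> (cis (\<omega> * t))))
        = (LINT t|lborel. f t * of_real (\<phi> (cis (\<omega> * t))) - f t * of_real (g (cis (\<omega> * t))))"
      using int G by simp
    also have "norm \<dots> \<le> (LINT t|lborel. e * norm (f t))"
    proof (rule order_trans[OF integral_norm_bound integral_mono])
      fix t
      have "\<bar>\<phi> (cis (\<omega> * t)) - g (cis (\<omega> * t))\<bar> \<le> e" using g(2)[of "cis (\<omega> * t)"] by simp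
      then show "norm (f t * of_real (\<phi> (cis (\<omega> * t))) - f t * of_real (g (cis (\<omega> * t)))) \<le> e * norm (f t)"
        unfolding right_diff_distrib[symmetric] of_real_diff[symmetric] norm_mult norm_of_real
        by (subst mult.commute) (intro mult_right_mono, auto)
    qed (use int G f in auto)
    finally show ?thesis by simp
  qed
  moreover have "((\<lambda>e. e * (LINT t|lborel. norm (f t))) \<longlongrightarrow> 0 * (LINT t|lborel. norm (f t))) (at_right 0)"
    by (intro tendsto_intros)
  ultimately have "norm (LINT t|lborel. f t * of_real (\<phi> (cis (\<omega> * t)))) \<le> 0"
    by (intro tendsto_lowerbound[where F = "at_right (0::real)"]) (auto simp: eventually_at_filter)
  then show ?thesis by simp
qed

text \<open>Superlevel sets of a cosine are the preimages of circular arcs. Their indicators are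
  pointwise limits of continuous functions on the circle, so dominated convergence reduces them to
  the continuous case.\<close>

lemma vanishing_fourier_times_arc:
  fixes f :: "real \<Rightarrow> complex"
  assumes f: "integrable lborel f"
    and z: "\<And>k::int. (LINT t|lborel. f t * cis (of_int k * (\<omega> * t))) = 0"
  shows "(LINT t|lborel. indicator {t. cos (\<omega> * (t - \<tau>)) > \<kappa>} t *\<^sub>R f t) = 0"
proof -
  have [measurable]: "f \<in> borel_measurable borel"
    using f by auto
  \<comment> \<open>A ramp clamped to the unit interval: 0 up to the level \<open>\<kappa>\<close>,
    and 1 once the level is exceeded by \<open>1 / n\<close>. At
    \<open>z = cis (\<omega> * t)\<close> the real part is
    \<open>cos (\<omega> * (t - \<tau>))\<close>.\<close>
  define \<phi> :: "nat \<Rightarrow> complex \<Rightarrow> real"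
    where "\<phi> n z = min 1 (max 0 (of_nat n * (Re (z * cis (- (\<omega> * \<tau>))) - \<kappa>)))" for n z
  have Re: "Re (cis (\<omega> * t) * cis (- (\<omega> * \<tau>))) = cos (\<omega> * (t - \<tau>))" for t
    by (simp add: cis_mult algebra_simps del: cis_mult[symmetric])
  have z0: "(LINT t|lborel. f t * of_real (\<phi> n (cis (\<omega> * t)))) = 0" for n
    by (rule vanishing_fourier_times_continuous[OF f z]) (auto simp: \<phi>_def intro!: continuous_intros)
  have "(\<lambda>n. LINT t|lborel. f t * of_real (\<phi> n (cis (\<omega> * t)))) \<longlonglongrightarrow>
     (LINT t|lborel. indicator {t. cos (\<omega> * (t - \<tau>)) > \<kappa>} t *\<^sub>R f t)"
  proof (rule integral_dominated_convergence[where w = "\<lambda>t. norm (f t)"])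
    show "AE t in lborel. (\<lambda>n. f t * of_real (\<phi> n (cis (\<omega> * t)))) \<longlonglongrightarrow>
      indicat_real {t. cos (\<omega> * (t - \<tau>)) > \<kappa>} t *\<^sub>R f t"
    proof (rule AE_I2)
      fix t
      let ?a = "cos (\<omega> * (t - \<tau>)) - \<kappa>"
      have "(\<lambda>n. \<phi> n (cis (\<omega> * t))) \<longlonglongrightarrow> indicat_real {t. cos (\<omega> * (t - \<tau>)) > \<kappa>} t"
      proof (cases "?a > 0")
        case True
        have "eventually (\<lambda>n. real n \<ge> 1 / ?a) sequentially"
          using filterlim_real_sequentially by (simp add: filterlim_at_top)
        then have "eventually (\<lambda>n. of_nat n * ?a \<ge> 1) sequentially"
          by eventually_elim (use True in \<open>simp add: field_simps\<close>)
        then have "eventually (\<lambda>n. \<phi> n (cis (\<omega> * t)) = 1) sequentially"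
          unfolding \<phi>_def Re by eventually_elim auto
        then show ?thesis using True by (simp add: tendsto_eventually)
      next
        case False
        then have "\<phi> n (cis (\<omega> * t)) = 0" for n
          unfolding \<phi>_def Re using mult_nonneg_nonpos[of "of_nat n" ?a] by auto
        then show ?thesis using False by simp
      qed
      then have "(\<lambda>n. f t * of_real (\<phi> n (cis (\<omega> * t)))) \<longlonglongrightarrow>
         f t * of_real (indicat_real {t. cos (\<omega> * (t - \<tau>)) > \<kappa>} t)" by (intro tendsto_intros)
      then show "(\<lambda>n. f t * of_real (\<phi> n (cis (\<omega> * t)))) \<longlonglongrightarrow>
         indicat_real {t. cos (\<omega> * (t - \<tau>)) > \<kappa>} t *\<^sub>R f t" by (simp add: scaleR_conv_of_real mult.commute)
    qed
    show "\<And>n. AE t in lborel. norm (f t * of_real (\<phi> n (cis (\<omega> * t)))) \<le> norm (f t)"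
      by (auto simp: \<phi>_def norm_mult intro!: mult_left_le)
    show "\<And>n. (\<lambda>t. f t * of_real (\<phi> n (cis (\<omega> * t)))) \<in> borel_measurable lborel"
      unfolding \<phi>_def Re by auto
  qed (use f in auto)
  then show ?thesis unfolding z0 using LIMSEQ_unique tendsto_const by blast
qed

lemma integrable_cis_mult:
  assumes "integrable lborel f"
  shows "integrable lborel (\<lambda>t. f t * cis (y * t))"
  using borel_measurable_integrable[OF assms]
  by (intro Bochner_Integration.integrable_bound[OF assms]) (auto simp: norm_mult)

text \<open>Past half a period the cosine rises again; by its symmetry about \<open>pi\<close> it
  returns to the level \<open>cos (\<omega> * h)\<close> exactly at
  \<open>2 * pi - \<omega> * h\<close>, which explains the last bound.\<close>

lemma cos_greater_iff_in_period:
  fixes d h \<omega> :: real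
  assumes "0 < \<omega>" "0 \<le> h" "\<omega> * h \<le> pi" "\<omega> * \<bar>d\<bar> \<le> 2 * pi - \<omega> * h"
  shows "cos (\<omega> * d) > cos (\<omega> * h) \<longleftrightarrow> \<bar>d\<bar> < h"
proof -
  have c: "cos (\<omega> * d) = cos (\<omega> * \<bar>d\<bar>)" by (cases "d \<ge> 0") auto
  have le: "\<omega> * \<bar>d\<bar> < \<omega> * h \<longleftrightarrow> \<bar>d\<bar> < h" using assms(1) by simp
  have nn: "0 \<le> \<omega> * \<bar>d\<bar>" "0 \<le> \<omega> * h" using assms by auto
  show ?thesis
  proof (cases "\<bar>d\<bar> < h")
    case True
    then show ?thesis using cos_monotone_0_pi[OF nn(1) _ assms(3)] le c by auto
  next
    case False
    have "cos (\<omega> * \<bar>d\<bar>) \<le> cos (\<omega> * h)"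
    proof (cases "\<omega> * \<bar>d\<bar> \<le> pi")
      case True
      then show ?thesis using False le nn by (intro cos_monotone_0_pi_le) auto
    next
      case 2: False
      have "cos (\<omega> * \<bar>d\<bar>) = cos (2 * pi - \<omega> * \<bar>d\<bar>)" by (simp add: cos_diff)
      also have "\<dots> \<le> cos (\<omega> * h)"
        using 2 nn assms by (intro cos_monotone_0_pi_le) auto
      finally show ?thesis .
    qed
    then show ?thesis using False c by auto
  qed
qed

text \<open>Inside one period an interval coincides with a single arc, so the arc integrals account
  for all interval integrals.\<close>

lemma fourier_series_zero_imp_AE_zero:
  fixes f :: "real \<Rightarrow> complex"
  assumes f: "integrable lborel f" and L: "L > 0"
    and supp: "AE t in lborel. t \<notin> {p..p + L} \<longrightarrow> f t = 0"
    and z: "\<And>k::int. (LINT t|lborel. f t * cis (of_int k * (2 * pi / L * t))) = 0"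
  shows "AE t in lborel. f t = 0"
proof (rule AE_zero_if_interval_integrals_zero[OF f])
  fix a b :: real
  have [measurable]: "f \<in> borel_measurable borel" using f by auto
  define a' b' where "a' = max a p" and "b' = min b (p + L)"
  show "(LINT t|lborel. indicat_real {a<..<b} t *\<^sub>R f t) = 0"
  proof (cases "a' < b'")
    case False
    have "AE t in lborel. indicat_real {a<..<b} t *\<^sub>R f t = 0"
      using supp by eventually_elim (use False L in \<open>auto simp: a'_def b'_def indicator_def split: if_splits\<close>)
    then show ?thesis by (rule integral_eq_zero_AE)
  next
    case True
    define \<tau> h where "\<tau> = (a' + b') / 2" and "h = (b' - a') / 2"
    let ?\<omega> = "2 * pi / L"
    have ab': "b' \<le> p + L" "p \<le> a'" by (auto simp: a'_def b'_def)
    then have h: "0 \<le> h" "h \<le> L / 2" using True by (auto simp: h_def)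
    have "(LINT t|lborel. indicat_real {a<..<b} t *\<^sub>R f t) =
      (LINT t|lborel. indicator {t. cos (?\<omega> * (t - \<tau>)) > cos (?\<omega> * h)} t *\<^sub>R f t)"
    proof (rule integral_cong_AE)
      show "AE t in lborel. indicat_real {a<..<b} t *\<^sub>R f t =
         indicator {t. cos (?\<omega> * (t - \<tau>)) > cos (?\<omega> * h)} t *\<^sub>R f t"
        using supp AE_lborel_singleton[of p] AE_lborel_singleton[of "p + L"]
      proof eventually_elim
        case (elim t)
        show ?case
        proof (cases "f t = 0")
          case False
          then have t: "p < t" "t < p + L" using elim by (auto simp: less_le)
          \<comment> \<open>The interval of half-width \<open>h\<close> lies in the period, so its
            midpoint is at least \<open>h\<close> away from both ends; hence \<open>t\<close> cannot
            reach a neighbouring copy of the arc.\<close>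
          have d: "\<bar>t - \<tau>\<bar> \<le> L - h"
            using t ab' unfolding \<tau>_def h_def abs_le_iff by (auto simp: field_simps)
          have "?\<omega> * \<bar>t - \<tau>\<bar> \<le> ?\<omega> * (L - h)" using d L by (intro mult_left_mono) auto
          then have "?\<omega> * \<bar>t - \<tau>\<bar> \<le> 2 * pi - ?\<omega> * h" using L by (simp add: field_simps)
          moreover have "?\<omega> * h \<le> pi" using h L by (simp add: field_simps)
          ultimately have "cos (?\<omega> * (t - \<tau>)) > cos (?\<omega> * h) \<longleftrightarrow> \<bar>t - \<tau>\<bar> < h"
            using h L by (intro cos_greater_iff_in_period) auto
          also have "\<dots> \<longleftrightarrow> a < t \<and> t < b"
            using t unfolding \<tau>_def h_def a'_def b'_def by (auto simp: abs_less_iff field_simps)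
          finally show ?thesis by (simp add: indicator_def)
        qed simp
      qed
    qed auto
    also have "\<dots> = 0" by (rule vanishing_fourier_times_arc[OF f z])
    finally show ?thesis .
  qed
qed

text \<open>There is no bounded support to fix a period, so the periods \<open>Suc n\<close> tend to
  infinity: any given \<open>t\<close> eventually meets only the copy of the arc that equals the
  interval, and dominated convergence applies.\<close>

lemma fourier_transform_zero_imp_AE_zero:
  fixes f :: "real \<Rightarrow> complex"
  assumes f: "integrable lborel f"
    and z: "\<And>y. (LINT t|lborel. f t * cis (y * t)) = 0"
  shows "AE t in lborel. f t = 0"
proof (rule AE_zero_if_interval_integrals_zero[OF f])
  fix a b :: real
  have [measurable]: "f \<in> borel_measurable borel" using f by auto
  show "(LINT t|lborel. indicat_real {a<..<b} t *\<^sub>R f t) = 0"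
  proof (cases "a < b")
    case True
    define \<tau> h where "\<tau> = (a + b) / 2" and "h = (b - a) / 2"
    define \<omega> where "\<omega> n = 2 * pi / real (Suc n)" for n
    have "(\<lambda>n. LINT t|lborel. indicat_real {t. cos (\<omega> n * (t - \<tau>)) > cos (\<omega> n * h)} t *\<^sub>R f t) \<longlonglongrightarrow>
      (LINT t|lborel. indicat_real {a<..<b} t *\<^sub>R f t)"
    proof (rule integral_dominated_convergence[where w = "\<lambda>t. norm (f t)"])
      show "AE t in lborel. (\<lambda>n. indicat_real {t. cos (\<omega> n * (t - \<tau>)) > cos (\<omega> n * h)} t *\<^sub>R f t) \<longlonglongrightarrow>
        indicat_real {a<..<b} t *\<^sub>R f t"
      proof (rule AE_I2)
        fix t
        have "eventually (\<lambda>n. real n > 2 * (\<bar>t - \<tau>\<bar> + h)) sequentially"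
          using filterlim_real_sequentially by (simp add: filterlim_at_top_dense)
        then have "eventually (\<lambda>n. indicat_real {t. cos (\<omega> n * (t - \<tau>)) > cos (\<omega> n * h)} t *\<^sub>R f t
            = indicat_real {a<..<b} t *\<^sub>R f t) sequentially"
        proof eventually_elim
          case (elim n)
          have h: "0 \<le> h" using True by (simp add: h_def)
          have "2 * \<bar>t - \<tau>\<bar> + 2 * h < real n" using elim by simp
          moreover have "2 * h \<le> 2 * \<bar>t - \<tau>\<bar> + 2 * h" "2 * \<bar>t - \<tau>\<bar> \<le> 2 * \<bar>t - \<tau>\<bar> + 2 * h" using h by auto
          ultimately have "2 * \<bar>t - \<tau>\<bar> < real n" "2 * h < real n" by (blast intro: le_less_trans)+
          then have "\<bar>t - \<tau>\<bar> \<le> real (Suc n) / 2" "h \<le> real (Suc n) / 2" by simp_all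
          moreover have "\<omega> n * x \<le> pi" if "x \<le> real (Suc n) / 2" for x
          proof -
            have "\<omega> n * x \<le> \<omega> n * (real (Suc n) / 2)"
              using that by (intro mult_left_mono) (auto simp: \<omega>_def)
            then show ?thesis by (simp add: \<omega>_def)
          qed
          ultimately have 1: "\<omega> n * \<bar>t - \<tau>\<bar> \<le> pi" "\<omega> n * h \<le> pi" by blast+
          have "cos (\<omega> n * (t - \<tau>)) > cos (\<omega> n * h) \<longleftrightarrow> \<bar>t - \<tau>\<bar> < h"
            using h 1 by (intro cos_greater_iff_in_period) (auto simp: \<omega>_def)
          also have "\<dots> \<longleftrightarrow> a < t \<and> t < b"
            unfolding \<tau>_def h_def by (auto simp: abs_less_iff field_simps)
          finally show ?case by (simp add: indicator_def)
        qed
        then show "(\<lambda>n. indicat_real {t. cos (\<omega> n * (t - \<tau>)) > cos (\<omega> n * h)} t *\<^sub>R f t) \<longlonglongrightarrow>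
          indicat_real {a<..<b} t *\<^sub>R f t"
          by (rule tendsto_eventually)
      qed
    qed (use f in \<open>auto simp: indicator_def\<close>)
    moreover have "(LINT t|lborel. indicat_real {t. cos (\<omega> n * (t - \<tau>)) > cos (\<omega> n * h)} t *\<^sub>R f t) = 0" for n
    proof (rule vanishing_fourier_times_arc[OF f])
      fix k :: int
      show "(LINT t|lborel. f t * cis (of_int k * (\<omega> n * t))) = 0"
        using z[of "of_int k * \<omega> n"] by (simp add: mult.assoc)
    qed
    ultimately show ?thesis by (simp add: LIMSEQ_const_iff)
  qed simp
qed

section \<open>Constancy on an interval from Fourier coefficients\<close>

lemma integral_cis_interval:
  assumes "p \<le> q" "y \<noteq> 0"
  shows "(LINT t|lborel. indicat_real {p..q} t *\<^sub>R cis (y * t)) = (cis (y * q) - cis (y * p)) / (\<i> * of_real y)"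
proof -
  have "(LINT t|lborel. indicat_real {p..q} t *\<^sub>R cis (y * t))
      = cis (y * q) / (\<i> * of_real y) - cis (y * p) / (\<i> * of_real y)"
  proof (rule integral_FTC_Icc[OF assms(1)])
    fix t
    have "((\<lambda>t. exp (\<i> * of_real y * t) / (\<i> * of_real y)) has_field_derivative exp (\<i> * of_real y * of_real t)) (at (of_real t))"
      using assms(2) by (auto intro!: derivative_eq_intros)
    from has_vector_derivative_real_field[OF this]
    show "((\<lambda>t. cis (y * t) / (\<i> * of_real y)) has_vector_derivative cis (y * t)) (at t within {p..q})"
      by (simp add: cis_conv_exp mult.assoc)
  qed (auto intro!: continuous_intros)
  then show ?thesis by (simp add: diff_divide_distrib)
qed

lemma integral_cis_full_periods:
  assumes "p < q" "k \<noteq> 0"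
  shows "(LINT t|lborel. indicat_real {p..q} t *\<^sub>R cis (of_int k * (2 * pi / (q - p) * t))) = 0"
proof -
  let ?y = "of_int k * (2 * pi / (q - p))"
  have "?y * q = ?y * p + 2 * pi * of_int k" using assms(1) by (simp add: field_simps)
  then have "cis (?y * q) = cis (?y * p)"
    by (simp add: cis_mult[symmetric] cis_multiple_2pi)
  then show ?thesis using integral_cis_interval[of p q ?y] assms by (simp add: mult.assoc)
qed

text \<open>The indicator of the full period has only the coefficient at \<open>k = 0\<close>.
  Subtracting the mean value times this indicator removes the one remaining coefficient of
  \<open>f\<close>, and uniqueness applies.\<close>

lemma AE_const_if_fourier_series_zero:
  fixes f :: "real \<Rightarrow> complex"
  assumes f: "integrable lborel f" and pq: "p < q"
    and supp: "AE t in lborel. t \<notin> {p..q} \<longrightarrow> f t = 0"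
    and z: "\<And>k::int. k \<noteq> 0 \<Longrightarrow> (LINT t|lborel. f t * cis (of_int k * (2 * pi / (q - p) * t))) = 0"
  shows "AE t in lborel. t \<in> {p..q} \<longrightarrow> f t = (LINT t|lborel. f t) / of_real (q - p)"
proof -
  define L where "L = q - p"
  have L: "L > 0" using pq by (simp add: L_def)
  have ind: "a * indicator {p..q} t * b = a * (indicat_real {p..q} t *\<^sub>R b)" for a b :: complex and t
    by (simp add: indicator_def)
  define \<gamma> where "\<gamma> = (LINT t|lborel. f t) / L"
  define g where "g t = f t - \<gamma> * indicator {p..q} t" for t
  have intind: "integrable lborel (\<lambda>t. \<gamma> * indicator {p..q} t)"
  proof -
    have "integrable lborel (\<lambda>t. \<gamma> * of_real (indicat_real {p..q} t))"
      by (intro integrable_mult_right integrable_of_real integrable_real_indicator) (use pq in auto)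
    moreover have "complex_of_real (indicat_real {p..q} t) = indicator {p..q} t" for t by (simp add: indicator_def)
    ultimately show ?thesis by simp
  qed
  have "AE t in lborel. g t = 0"
  proof (rule fourier_series_zero_imp_AE_zero[OF _ L, of _ p])
    show "integrable lborel g" unfolding g_def using f intind by auto
    show "AE t in lborel. t \<notin> {p..p + L} \<longrightarrow> g t = 0"
      using supp by eventually_elim (auto simp: g_def L_def)
    fix k :: int
    let ?y = "of_int k * (2 * pi / L)"
    have "(LINT t|lborel. g t * cis (?y * t)) =
       (LINT t|lborel. f t * cis (?y * t)) - (LINT t|lborel. \<gamma> * indicator {p..q} t * cis (?y * t))"
      unfolding g_def left_diff_distrib using f intind
      by (intro Bochner_Integration.integral_diff integrable_cis_mult)
    also have "(LINT t|lborel. \<gamma> * indicator {p..q} t * cis (?y * t))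
        = \<gamma> * (LINT t|lborel. indicat_real {p..q} t *\<^sub>R cis (?y * t))"
      unfolding ind by (simp only: integral_mult_right_zero)
    also have "(LINT t|lborel. f t * cis (?y * t)) = \<dots>"
    proof (cases "k = 0")
      case True then show ?thesis using L by (simp add: \<gamma>_def L_def scaleR_conv_of_real)
    next
      case False then show ?thesis
        using z integral_cis_full_periods[OF pq] by (simp add: mult.assoc L_def)
    qed
    finally show "(LINT t|lborel. g t * cis (of_int k * (2 * pi / L * t))) = 0" by (simp add: mult.assoc)
  qed
  then show ?thesis by eventually_elim (auto simp: g_def \<gamma>_def L_def)
qed

text \<open>The modulus suffices: its zeros at nonzero multiples of the basic frequency force
  constancy, and its value at \<open>y = 0\<close> gives the size of the constant.\<close>

lemma AE_const_if_fourier_modulus_const: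
  fixes f :: "real \<Rightarrow> complex"
  assumes f: "integrable lborel f" and pq: "p < q"
    and supp: "AE t in lborel. t \<notin> {p..q} \<longrightarrow> f t = 0"
    and eq: "\<And>y. cmod (LINT t|lborel. f t * cis (y * t)) = cmod (LINT t|lborel. C * indicator {p..q} t * cis (y * t))"
  shows "\<exists>\<gamma>. cmod \<gamma> = cmod C \<and> (AE t in lborel. t \<in> {p..q} \<longrightarrow> f t = \<gamma>)"
proof -
  have ind: "C * indicator {p..q} t * b = C * (indicat_real {p..q} t *\<^sub>R b)" for b :: complex and t
    by (simp add: indicator_def)
  have eq': "cmod (LINT t|lborel. f t * cis (y * t))
      = cmod C * cmod (LINT t|lborel. indicat_real {p..q} t *\<^sub>R cis (y * t))" for y
    unfolding eq ind by (simp only: integral_mult_right_zero norm_mult)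
  have "AE t in lborel. t \<in> {p..q} \<longrightarrow> f t = (LINT t|lborel. f t) / of_real (q - p)"
  proof (rule AE_const_if_fourier_series_zero[OF f pq supp])
    fix k :: int assume "k \<noteq> 0"
    then show "(LINT t|lborel. f t * cis (of_int k * (2 * pi / (q - p) * t))) = 0"
      using eq'[of "of_int k * (2 * pi / (q - p))"] integral_cis_full_periods[OF pq] by (simp add: mult.assoc)
  qed
  moreover have "cmod ((LINT t|lborel. f t) / of_real (q - p)) = cmod C"
    using eq'[of 0] pq by (simp add: norm_divide del: of_real_diff)
  ultimately show ?thesis by blast
qed

text \<open>By Tonelli, integrating the moduli of the shifted products over all shifts gives the
  product of the integrals of the two moduli. That product is 0, hence one factor is; infinite
  values are harmless in \<open>ennreal\<close>.\<close>

lemma AE_zero_if_all_shifted_products_zero: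
  fixes f g :: "real \<Rightarrow> complex"
  assumes [measurable]: "f \<in> borel_measurable borel" "g \<in> borel_measurable borel"
    and z: "\<And>x. AE t in lborel. f t * g (t - x) = 0"
  shows "(AE t in lborel. f t = 0) \<or> (AE t in lborel. g t = 0)"
proof -
  define F G where "F t = ennreal (norm (f t))" and "G t = ennreal (norm (g t))" for t
  have [measurable]: "F \<in> borel_measurable borel" "G \<in> borel_measurable borel"
    unfolding F_def G_def by measurable
  have "(\<integral>\<^sup>+t. F t \<partial>lborel) * (\<integral>\<^sup>+s. G s \<partial>lborel) = (\<integral>\<^sup>+t. F t * (\<integral>\<^sup>+x. G (t - x) \<partial>lborel) \<partial>lborel)"
  proof -
    have "(\<integral>\<^sup>+x. G (t - x) \<partial>lborel) = (\<integral>\<^sup>+s. G s \<partial>lborel)" for t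
      using nn_integral_real_affine[of G "-1" t] by simp
    then show ?thesis by (simp add: nn_integral_multc)
  qed
  also have "\<dots> = (\<integral>\<^sup>+t. \<integral>\<^sup>+x. F t * G (t - x) \<partial>lborel \<partial>lborel)"
    by (simp add: nn_integral_cmult)
  also have "\<dots> = (\<integral>\<^sup>+x. \<integral>\<^sup>+t. F t * G (t - x) \<partial>lborel \<partial>lborel)"
    by (rule lborel_pair.Fubini') measurable
  also have "\<dots> = (\<integral>\<^sup>+x. 0 \<partial>(lborel :: real measure))"
  proof (rule nn_integral_cong)
    fix x :: real
    have "AE t in lborel. F t * G (t - x) = 0"
      using z[of x] by eventually_elim (auto simp: F_def G_def)
    then show "(\<integral>\<^sup>+t. F t * G (t - x) \<partial>lborel) = 0" by (subst nn_integral_0_iff_AE) auto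
  qed
  finally have "(\<integral>\<^sup>+t. F t \<partial>lborel) = 0 \<or> (\<integral>\<^sup>+s. G s \<partial>lborel) = 0" by simp
  then show ?thesis by (auto simp: nn_integral_0_iff_AE F_def G_def)
qed

section \<open>Ambiguity functions and trivial transforms\<close>

lemma borel_measurable_cnj [measurable]: "cnj \<in> borel_measurable borel"
  by (intro borel_measurable_continuous_onI continuous_intros)

lemma L2_measurable [measurable_dest]: "v \<in> L2 \<Longrightarrow> v \<in> borel_measurable borel"
  by (simp add: L2_def)

lemma L2_affine:
  assumes "v \<in> L2" "c \<noteq> 0"
  shows "(\<lambda>t. cis (\<theta> + b * t) * v (c * t - a)) \<in> L2"
proof -
  have [measurable]: "v \<in> borel_measurable borel" using assms(1) by (rule L2_measurable)
  have "integrable lborel (\<lambda>t. (cmod (v t))\<^sup>2)" using assms(1) by (simp add: L2_def)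
  from lborel_integrable_real_affine[OF this assms(2), of "-a"]
  show ?thesis by (simp add: L2_def norm_mult add.commute)
qed

lemma integrable_L2_mult:
  assumes "v \<in> L2" "w \<in> L2"
  shows "integrable lborel (\<lambda>t. v t * w t)"
proof (rule Bochner_Integration.integrable_bound)
  have [measurable]: "v \<in> borel_measurable borel" "w \<in> borel_measurable borel"
    using assms by (auto intro: L2_measurable)
  show "integrable lborel (\<lambda>t. (cmod (v t))\<^sup>2 + (cmod (w t))\<^sup>2)"
    using assms by (intro Bochner_Integration.integrable_add) (auto simp: L2_def)
  show "(\<lambda>t. v t * w t) \<in> borel_measurable lborel" by measurable
  have "a * b \<le> a\<^sup>2 + b\<^sup>2" if "a \<ge> 0" "b \<ge> 0" for a b :: real
    using sum_squares_bound[of a b] mult_nonneg_nonneg[OF that] unfolding mult.assoc by linarith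
  then show "AE t in lborel. norm (v t * w t) \<le> norm ((cmod (v t))\<^sup>2 + (cmod (w t))\<^sup>2)"
    by (simp add: norm_mult)
qed

lemma integrable_ambiguity:
  assumes "v \<in> L2"
  shows "integrable lborel (\<lambda>t. v t * cnj (v (t - x)))"
proof -
  have "(\<lambda>t. v (t - x)) \<in> L2" using L2_affine[OF assms, of 1 0 0 x] by simp
  then have "(\<lambda>t. cnj (v (t - x))) \<in> L2" by (auto simp: L2_def)
  then show ?thesis by (rule integrable_L2_mult[OF assms])
qed

lemma integrable_L2_interval:
  assumes "v \<in> L2"
  shows "integrable lborel (\<lambda>t. indicator {p..q} t * v t)"
proof -
  have [measurable]: "v \<in> borel_measurable borel" using assms by (rule L2_measurable)
  have "emeasure lborel {p..q} < \<infinity>" by (cases "p \<le> q") auto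
  moreover have "(\<lambda>t. (cmod (indicator {p..q} t))\<^sup>2) = indicat_real {p..q}"
    by (auto simp: indicator_def)
  ultimately have "(\<lambda>t. indicator {p..q} t :: complex) \<in> L2"
    unfolding L2_def by (auto intro!: integrable_real_indicator)
  then show ?thesis using assms by (rule integrable_L2_mult)
qed

lemma ambiguity_cong_AE:
  assumes "AE t in lborel. v t = w t"
    and [measurable]: "v \<in> borel_measurable borel" "w \<in> borel_measurable borel"
  shows "ambiguity v x y = ambiguity w x y"
  unfolding ambiguity_def
proof (rule integral_cong_AE)
  have "AE t in lborel. v (- x + 1 * t) = w (- x + 1 * t)" by (rule AE_lborel_affine[OF assms(1)]) simp
  then have "AE t in lborel. v (t - x) = w (t - x)" by simp
  then show "AE t in lborel. v t * cnj (v (t - x)) * cis (y * t) = w t * cnj (w (t - x)) * cis (y * t)"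
    using assms(1) by eventually_elim auto
qed auto

text \<open>The constant phase cancels against its conjugate, the modulation leaves a phase in
  \<open>x\<close>, and the substitution \<open>\<epsilon> * t - a\<close> leaves one in
  \<open>y\<close>, so all trivial operations are treated at once.\<close>

lemma ambiguity_transform:
  assumes [measurable]: "u \<in> borel_measurable borel" and "\<epsilon> \<noteq> 0" "\<epsilon>\<^sup>2 = (1::real)"
  shows "ambiguity (\<lambda>t. cis (\<theta> + b * t) * u (\<epsilon> * t - a)) x y
    = cis (b * x + y * \<epsilon> * a) * ambiguity u (\<epsilon> * x) (\<epsilon> * y)"
proof -
  have e: "\<epsilon> * (\<epsilon> * r) = r" for r using assms(3) by (simp add: power2_eq_square mult.assoc[symmetric])
  have abs: "\<bar>\<epsilon>\<bar> = 1" using assms(3) by (simp add: power2_eq_1_iff) auto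
  have "ambiguity u (\<epsilon> * x) (\<epsilon> * y)
     = (LINT t|lborel. u (\<epsilon> * t - a) * cnj (u (\<epsilon> * t - a - \<epsilon> * x)) * cis (\<epsilon> * y * (\<epsilon> * t - a)))"
    unfolding ambiguity_def by (subst lborel_integral_real_affine[OF assms(2), of _ "- a"]) (simp add: abs)
  moreover have key: "cis (\<theta> + b * t) * u (\<epsilon> * t - a) * cnj (cis (\<theta> + b * (t - x)) * u (\<epsilon> * (t - x) - a)) * cis (y * t)
     = cis (b * x + y * \<epsilon> * a) * (u (\<epsilon> * t - a) * cnj (u (\<epsilon> * t - a - \<epsilon> * x)) * cis (\<epsilon> * y * (\<epsilon> * t - a)))" for t
  proof -
    have 1: "\<epsilon> * (t - x) - a = \<epsilon> * t - a - \<epsilon> * x" by (simp add: algebra_simps)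
    have "b * x + y * \<epsilon> * a + \<epsilon> * y * (\<epsilon> * t - a) = \<theta> + b * t - (\<theta> + b * (t - x)) + y * t"
      using e[of "t * y"] by (simp add: algebra_simps)
    then have "cis (b * x + y * \<epsilon> * a) * cis (\<epsilon> * y * (\<epsilon> * t - a)) = cis (\<theta> + b * t) * cis (- (\<theta> + b * (t - x))) * cis (y * t)"
      by (simp only: cis_mult) (simp add: algebra_simps)
    then show ?thesis unfolding 1 by (simp add: cis_cnj mult_ac)
  qed
  ultimately show ?thesis
    unfolding ambiguity_def[of "\<lambda>t. cis (\<theta> + b * t) * u (\<epsilon> * t - a)"] key by simp
qed

text \<open>Reflection evaluates the ambiguity function at \<open>(- x, - y)\<close>; the
  substitution of \<open>t - x\<close> for \<open>t\<close> shows that this costs only a conjugation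
  and a phase.\<close>

lemma ambiguity_minus:
  assumes [measurable]: "u \<in> borel_measurable borel"
  shows "ambiguity u (- x) (- y) = cis (x * y) * cnj (ambiguity u x y)"
proof -
  have "ambiguity u (- x) (- y) = (LINT t|lborel. u t * cnj (u (t + x)) * cis (- (y * t)))"
    by (simp add: ambiguity_def)
  also have "\<dots> = (LINT t|lborel. u (- x + t) * cnj (u t) * cis (- (y * (t - x))))"
    by (subst lborel_integral_real_affine[of 1 _ "- x"]) (auto simp: algebra_simps)
  also have "\<dots> = (LINT t|lborel. cis (x * y) * cnj (u t * cnj (u (t - x)) * cis (y * t)))"
  proof (rule Bochner_Integration.integral_cong)
    fix t
    have "cis (- (y * (t - x))) = cis (x * y) * cis (- (y * t))"
      by (simp add: cis_mult algebra_simps)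
    then show "u (- x + t) * cnj (u t) * cis (- (y * (t - x))) = cis (x * y) * cnj (u t * cnj (u (t - x)) * cis (y * t))"
      by (simp add: cis_cnj mult_ac)
  qed simp
  also have "\<dots> = cis (x * y) * cnj (ambiguity u x y)"
    by (simp add: ambiguity_def del: complex_cnj_mult)
  finally show ?thesis .
qed

lemma cmod_ambiguity_trivial_transform:
  assumes "trivial_transform u v" and uv [measurable]: "u \<in> borel_measurable borel" "v \<in> borel_measurable borel"
  shows "cmod (ambiguity v x y) = cmod (ambiguity u x y)"
proof -
  obtain \<epsilon> a b \<theta> where e: "\<epsilon> \<in> {-1, 1}" and v: "AE t in lborel. v t = cis (\<theta> + b * t) * u (\<epsilon> * t - a)"
    using assms(1) unfolding trivial_transform_def by blast
  have "ambiguity v x y = ambiguity (\<lambda>t. cis (\<theta> + b * t) * u (\<epsilon> * t - a)) x y"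
    by (rule ambiguity_cong_AE[OF v]) auto
  also have "\<dots> = cis (b * x + y * \<epsilon> * a) * ambiguity u (\<epsilon> * x) (\<epsilon> * y)"
    by (rule ambiguity_transform[OF uv(1)]) (use e in auto)
  finally show ?thesis using e by (auto simp: ambiguity_minus[OF uv(1)] norm_mult)
qed

lemma trivial_transform_AE_eq:
  assumes "AE t in lborel. v t = u t"
  shows "trivial_transform u v"
  unfolding trivial_transform_def using assms
  by (intro bexI[of _ 1] exI[of _ 0]) auto

lemma trivial_transform_affine: "\<epsilon> \<in> {-1, 1} \<Longrightarrow> trivial_transform u (\<lambda>t. cis (\<theta> + b * t) * u (\<epsilon> * t - a))"
  unfolding trivial_transform_def by (intro bexI[of _ \<epsilon>] exI[of _ a] exI[of _ b] exI[of _ \<theta>]) auto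

lemma trivial_transform_sym:
  assumes "trivial_transform u v" shows "trivial_transform v u"
proof -
  obtain \<epsilon> a b \<theta> where e: "\<epsilon> \<in> {-1, 1}" and v: "AE t in lborel. v t = cis (\<theta> + b * t) * u (\<epsilon> * t - a)"
    using assms unfolding trivial_transform_def by blast
  \<comment> \<open>Since \<open>\<epsilon>\<close> is its own inverse, this argument inverts the
    map \<open>\<epsilon> * t - a\<close>.\<close>
  have "AE t in lborel. v (\<epsilon> * a + \<epsilon> * t) = cis (\<theta> + b * (\<epsilon> * a + \<epsilon> * t)) * u (\<epsilon> * (\<epsilon> * a + \<epsilon> * t) - a)"
    by (rule AE_lborel_affine[OF v]) (use e in auto)
  moreover have "\<epsilon> * (\<epsilon> * a + \<epsilon> * t) - a = t" for t using e by auto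
  ultimately have "AE t in lborel. v (\<epsilon> * a + \<epsilon> * t) = cis (\<theta> + b * (\<epsilon> * a + \<epsilon> * t)) * u t" by simp
  then have "AE t in lborel. u t = cis ((- \<theta> - b * \<epsilon> * a) + (- b * \<epsilon>) * t) * v (\<epsilon> * t - (- \<epsilon> * a))"
  proof eventually_elim
    case (elim t)
    have "(- \<theta> - b * \<epsilon> * a) + (- b * \<epsilon>) * t = - (\<theta> + b * (\<epsilon> * a + \<epsilon> * t))" by (simp add: algebra_simps)
    moreover have "\<epsilon> * t - (- \<epsilon> * a) = \<epsilon> * a + \<epsilon> * t" by simp
    ultimately show ?case
      by (simp only: elim) (simp add: cis_mult mult.assoc[symmetric])
  qed
  then show ?thesis unfolding trivial_transform_def using e by blast
qed

lemma trivial_transform_trans: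
  assumes "trivial_transform u v" "trivial_transform v w" shows "trivial_transform u w"
proof -
  obtain \<epsilon> a b \<theta> where e: "\<epsilon> \<in> {-1, 1}" and v: "AE t in lborel. v t = cis (\<theta> + b * t) * u (\<epsilon> * t - a)"
    using assms(1) unfolding trivial_transform_def by blast
  obtain \<epsilon>' a' b' \<theta>' where e': "\<epsilon>' \<in> {-1, 1}" and w: "AE t in lborel. w t = cis (\<theta>' + b' * t) * v (\<epsilon>' * t - a')"
    using assms(2) unfolding trivial_transform_def by blast
  have "AE t in lborel. v (- a' + \<epsilon>' * t) = cis (\<theta> + b * (- a' + \<epsilon>' * t)) * u (\<epsilon> * (- a' + \<epsilon>' * t) - a)"
    by (rule AE_lborel_affine[OF v]) (use e' in auto)
  with w have "AE t in lborel. w t = cis ((\<theta>' + \<theta> - b * a') + (b' + b * \<epsilon>') * t) * u ((\<epsilon> * \<epsilon>') * t - (\<epsilon> * a' + a))"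
  proof eventually_elim
    case (elim t)
    have w: "w t = cis (\<theta>' + b' * t) * (cis (\<theta> + b * (- a' + \<epsilon>' * t)) * u (\<epsilon> * (- a' + \<epsilon>' * t) - a))"
      using elim by simp
    have eqs: "(\<theta>' + \<theta> - b * a') + (b' + b * \<epsilon>') * t = \<theta>' + b' * t + (\<theta> + b * (- a' + \<epsilon>' * t))"
      "\<epsilon> * (- a' + \<epsilon>' * t) - a = (\<epsilon> * \<epsilon>') * t - (\<epsilon> * a' + a)" by (simp_all add: algebra_simps)
    show ?case unfolding w eqs by (simp only: cis_mult[symmetric] mult.assoc)
  qed
  moreover have "\<epsilon> * \<epsilon>' \<in> {-1, 1}" using e e' by auto
  ultimately show ?thesis unfolding trivial_transform_def by blast
qed

lemma AE_product_zero_if_ambiguity_zero: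
  assumes "v \<in> L2" "\<And>y. ambiguity v x y = 0"
  shows "AE t in lborel. v t * cnj (v (t - x)) = 0"
  using fourier_transform_zero_imp_AE_zero[OF integrable_ambiguity[OF assms(1)]] assms(2)
  by (simp add: ambiguity_def)

lemma AE_product_const_if_ambiguity:
  assumes u [measurable]: "u \<in> borel_measurable borel" and v: "v \<in> L2" and "p < q"
    and "AE t in lborel. t \<notin> {p..q} \<longrightarrow> v t * cnj (v (t - x)) = 0"
    and eq: "\<And>y. cmod (ambiguity v x y) = cmod (ambiguity u x y)"
    and ux: "AE t in lborel. u t * cnj (u (t - x)) = C * indicator {p..q} t"
  shows "\<exists>\<gamma>. cmod \<gamma> = cmod C \<and> (AE t in lborel. t \<in> {p..q} \<longrightarrow> v t * cnj (v (t - x)) = \<gamma>)"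
proof (rule AE_const_if_fourier_modulus_const[OF integrable_ambiguity[OF v] assms(3,4)])
  fix y
  have "ambiguity u x y = (LINT t|lborel. C * indicator {p..q} t * cis (y * t))"
    unfolding ambiguity_def
    by (rule integral_cong_AE) (use ux in \<open>auto elim: eventually_mono\<close>)
  then show "cmod (LINT t|lborel. v t * cnj (v (t - x)) * cis (y * t)) =
     cmod (LINT t|lborel. C * indicator {p..q} t * cis (y * t))"
    using eq[of y] by (simp add: ambiguity_def)
qed

section \<open>Support and shape of a function from its shifted products\<close>

text \<open>For each cut \<open>q\<close>, the part of \<open>v\<close> left of \<open>q\<close> and
  the part right of \<open>q + D\<close> are more than \<open>D\<close> apart, so one of them
  vanishes. The supremum of the cuts with vanishing left part is the left end of the support
  interval.\<close>

lemma AE_supported_in_interval: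
  fixes v :: "real \<Rightarrow> complex"
  assumes [measurable]: "v \<in> borel_measurable borel" and D: "D \<ge> 0"
    and z: "\<And>x. x > D \<Longrightarrow> AE t in lborel. v t * cnj (v (t - x)) = 0"
  shows "\<exists>a. AE t in lborel. t \<notin> {a..a + D} \<longrightarrow> v t = 0"
proof -
  define L where "L q \<longleftrightarrow> (AE t in lborel. t < q \<longrightarrow> v t = 0)" for q
  define R where "R q \<longleftrightarrow> (AE t in lborel. q < t \<longrightarrow> v t = 0)" for q
  have LR: "L q \<or> R (q + D)" for q
  proof -
    have "(AE t in lborel. v t * indicator {q + D<..} t = 0) \<or> (AE t in lborel. cnj (v t) * indicator {..<q} t = 0)"
    proof (rule AE_zero_if_all_shifted_products_zero)
      fix x
      \<comment> \<open>For shifts up to \<open>D\<close> the two truncated factors never meet, so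
        every shift is covered.\<close>
      show "AE t in lborel. (v t * indicator {q + D<..} t) * (cnj (v (t - x)) * indicator {..<q} (t - x)) = 0"
      proof (cases "x > D")
        case True
        show ?thesis using z[OF True] by eventually_elim (auto simp: indicator_def)
      qed (auto simp: indicator_def)
    qed auto
    then show ?thesis
    proof
      assume "AE t in lborel. v t * indicator {q + D<..} t = 0"
      then have "R (q + D)" unfolding R_def by eventually_elim (auto simp: indicator_def)
      then show ?thesis ..
    next
      assume "AE t in lborel. cnj (v t) * indicator {..<q} t = 0"
      then have "L q" unfolding L_def by eventually_elim (auto simp: indicator_def)
      then show ?thesis ..
    qed
  qed
  have mono: "L q'" if "L q" "q' \<le> q" for q q'
    using that(1) unfolding L_def by eventually_elim (use that(2) in auto)
  have L_all: "AE t in lborel. v t = 0" if "\<And>n::nat. L (q n)" "\<And>t. \<exists>n. t < q n" for q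
  proof -
    have "AE t in lborel. \<forall>n. t < q n \<longrightarrow> v t = 0"
      using that(1) unfolding L_def AE_all_countable by blast
    then show ?thesis by eventually_elim (use that(2) in blast)
  qed
  have R_all: "AE t in lborel. v t = 0" if "\<And>n::nat. R (q n)" "\<And>t. \<exists>n. q n < t" for q
  proof -
    have "AE t in lborel. \<forall>n. q n < t \<longrightarrow> v t = 0"
      using that(1) unfolding R_def AE_all_countable by blast
    then show ?thesis by eventually_elim (use that(2) in blast)
  qed
  \<comment> \<open>A function that vanishes almost everywhere has no largest vanishing left part,
    so the supremum is only formed in the other case.\<close>
  show ?thesis
  proof (cases "AE t in lborel. v t = 0")
    case True
    then show ?thesis by (intro exI[of _ 0]) (auto elim: eventually_mono)
  next
    case False
    have exL: "\<exists>q. L q"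
    proof (rule ccontr)
      assume "\<not> ?thesis"
      then have "R (- real n + D)" for n using LR by blast
      moreover have "\<exists>n. - real n + D < t" for t using reals_Archimedean2[of "D - t"] by (auto simp: algebra_simps)
      ultimately show False using R_all[of "\<lambda>n. - real n + D"] False by blast
    qed
    have "\<exists>q. \<not> L q"
    proof (rule ccontr)
      assume "\<not> ?thesis"
      then have "L (real n)" for n by blast
      then show False using L_all reals_Archimedean2 False by blast
    qed
    then obtain B where "\<not> L B" by blast
    then have B: "q \<le> B" if "L q" for q using mono[OF that, of B] by (meson linear)
    define a where "a = Sup (Collect L)"
    have bdd: "bdd_above (Collect L)" using B by (intro bdd_aboveI[of _ B]) auto
    have "L q" if "q < a" for q
    proof -
      obtain q' where "L q'" "q < q'" using less_cSupD[of "Collect L" q] \<open>q < a\<close> exL unfolding a_def by blast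
      then show ?thesis using mono by fastforce
    qed
    \<comment> \<open>Cuts increasing to \<open>a\<close> along a sequence merge the null sets of
      the individual cuts into one.\<close>
    then have "L (a - inverse (real (Suc n)))" for n by simp
    then have "AE t in lborel. \<forall>n. t < a - inverse (real (Suc n)) \<longrightarrow> v t = 0"
      unfolding L_def AE_all_countable by blast
    then have left: "AE t in lborel. t < a \<longrightarrow> v t = 0"
    proof eventually_elim
      case (elim t)
      show ?case
      proof
        assume "t < a"
        then obtain n where "inverse (real (Suc n)) < a - t" using reals_Archimedean[of "a - t"] by auto
        then show "v t = 0" using elim[rule_format, of n] by auto
      qed
    qed
    have "R (q + D)" if "q > a" for q
    proof -
      have "\<not> L q" using that cSup_upper[OF _ bdd, of q] by (auto simp: a_def)
      then show ?thesis using LR by blast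
    qed
    then have "R (a + inverse (real (Suc n)) + D)" for n by simp
    then have "AE t in lborel. \<forall>n. a + inverse (real (Suc n)) + D < t \<longrightarrow> v t = 0"
      unfolding R_def AE_all_countable by blast
    then have right: "AE t in lborel. a + D < t \<longrightarrow> v t = 0"
    proof eventually_elim
      case (elim t)
      show ?case
      proof
        assume "a + D < t"
        then obtain n where "inverse (real (Suc n)) < t - a - D" using reals_Archimedean[of "t - a - D"] by auto
        then show "v t = 0" using elim[rule_format, of n] by auto
      qed
    qed
    from left right have "AE t in lborel. t \<notin> {a..a + D} \<longrightarrow> v t = 0"
      by eventually_elim auto
    then show ?thesis ..
  qed
qed

text \<open>After a modulation \<open>f\<close> has period \<open>T / 2\<close>. Shifting multiplies the \<open>k\<close>-th Fourier coefficient both by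
  \<open>cis (2 \<pi> k s / h)\<close> and by a factor that does not depend on \<open>k\<close>, so only one coefficient can be nonzero.\<close>

lemma AE_exponential_if_shift_proportional:
  fixes f :: "real \<Rightarrow> complex"
  assumes T: "T > 0" and int: "integrable lborel (\<lambda>t. indicator {0..T} t * f t)"
    and [measurable]: "f \<in> borel_measurable borel"
    and shift: "\<And>s. 0 \<le> s \<Longrightarrow> s < T \<Longrightarrow> \<exists>g. cmod g = 1 \<and> (AE t in lborel. t \<in> {s..T} \<longrightarrow> f t = g * f (t - s))"
  shows "\<exists>\<alpha> \<beta>. AE t in lborel. t \<in> {0..T} \<longrightarrow> f t = \<alpha> * cis (\<beta> * t)"
proof -
  \<comment> \<open>With this period, every window of one period starting in \<open>{0..h}\<close>
    stays inside \<open>{0..T}\<close>.\<close>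
  define h where "h = T / 2"
  have h: "h > 0" "h < T" "T = 2 * h" using T by (auto simp: h_def)
  obtain g where g: "cmod g = 1" "AE t in lborel. t \<in> {h..T} \<longrightarrow> f t = g * f (t - h)"
    using shift[of h] h by auto
  \<comment> \<open>The modulation by \<open>- \<beta>\<close> absorbs the factor \<open>g\<close>
    of the shift by \<open>h\<close>, which makes \<open>F\<close> periodic.\<close>
  define \<beta> where "\<beta> = Arg g / h"
  have g\<beta>: "g = cis (\<beta> * h)"
    using g(1) h by (simp add: \<beta>_def) (metis norm_zero zero_neq_one cis_Arg sgn_eq div_by_1 of_real_1)
  define F where "F t = f t * cis (- \<beta> * t)" for t
  have [measurable]: "F \<in> borel_measurable borel" unfolding F_def by measurable
  have Fh: "AE t in lborel. t \<in> {h..T} \<longrightarrow> F t = F (t - h)"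
    using g(2)
  proof eventually_elim
    case (elim t)
    have "cis (\<beta> * h) * cis (- \<beta> * t) = cis (- \<beta> * (t - h))" by (simp add: cis_mult algebra_simps)
    then show ?case using elim by (simp add: F_def g\<beta> mult_ac)
  qed
  have Fs: "\<exists>g. AE t in lborel. t \<in> {s..T} \<longrightarrow> F t = g * F (t - s)" if s: "0 \<le> s" "s \<le> h" for s
  proof -
    obtain g where "AE t in lborel. t \<in> {s..T} \<longrightarrow> f t = g * f (t - s)"
      using shift[of s] h s by auto
    then have "AE t in lborel. t \<in> {s..T} \<longrightarrow> F t = g * cis (- \<beta> * s) * F (t - s)"
    proof eventually_elim
      case (elim t)
      have "cis (- \<beta> * t) = cis (- \<beta> * s) * cis (- \<beta> * (t - s))" by (simp add: cis_mult algebra_simps)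
      then show ?case using elim by (simp add: F_def mult_ac)
    qed
    then show ?thesis by blast
  qed
  define E where "E k t = cis (of_int k * (2 * pi / h * t))" for k :: int and t
  have [measurable]: "E k \<in> borel_measurable borel" for k unfolding E_def by measurable
  have E_add: "E k (s + t) = E k s * E k t" for k s t
    by (simp add: E_def cis_mult algebra_simps add_divide_distrib)
  have E_mult: "E (k + l) t = E k t * E l t" for k l t
    by (simp add: E_def cis_mult algebra_simps add_divide_distrib)
  have E_h: "E k h = 1" for k
    using h cis_multiple_2pi[of "of_int k"] by (simp add: E_def mult.commute)
  have E_per: "E k (t - h) = E k t" for k t
    using E_add[of k "t - h" h] E_h by simp
  \<comment> \<open>Up to normalization this is a Fourier coefficient of \<open>F\<close>, taken
    over the period that starts at \<open>s\<close>; by periodicity the start is irrelevant.\<close>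
  define J where "J k s = (LINT t|lborel. indicat_real {s..s + h} t *\<^sub>R (F t * E k t))" for k s
  have intG: "integrable lborel (\<lambda>t. indicat_real {p..q} t *\<^sub>R (F t * E k t))" if "0 \<le> p" "q \<le> T" for p q k
    by (rule Bochner_Integration.integrable_bound[OF int])
       (use that in \<open>auto simp: norm_mult F_def E_def indicator_def\<close>)
  have J_periodic: "J k s = J k 0" if s: "0 \<le> s" "s \<le> h" for k s
  proof -
    have split: "(LINT t|lborel. indicat_real {p..r} t *\<^sub>R (F t * E k t)) =
      (LINT t|lborel. indicat_real {p..q} t *\<^sub>R (F t * E k t)) + (LINT t|lborel. indicat_real {q..r} t *\<^sub>R (F t * E k t))"
      if "0 \<le> p" "p \<le> q" "q \<le> r" "r \<le> T" for p q r
    proof -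
      have "(LINT t|lborel. indicat_real {p..r} t *\<^sub>R (F t * E k t)) =
        (LINT t|lborel. indicat_real {p..q} t *\<^sub>R (F t * E k t) + indicat_real {q..r} t *\<^sub>R (F t * E k t))"
      proof (rule integral_cong_AE)
        show "AE t in lborel. indicat_real {p..r} t *\<^sub>R (F t * E k t) =
           indicat_real {p..q} t *\<^sub>R (F t * E k t) + indicat_real {q..r} t *\<^sub>R (F t * E k t)"
          using AE_lborel_singleton[of q] by eventually_elim (use that in \<open>auto simp: indicator_def\<close>)
      qed auto
      then show ?thesis using intG that by simp
    qed
    have "(LINT t|lborel. indicat_real {h..s + h} t *\<^sub>R (F t * E k t)) =
       (LINT t|lborel. indicat_real {h..s + h} t *\<^sub>R (F (t - h) * E k (t - h)))"
    proof (rule integral_cong_AE)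
      show "AE t in lborel. indicat_real {h..s + h} t *\<^sub>R (F t * E k t) =
         indicat_real {h..s + h} t *\<^sub>R (F (t - h) * E k (t - h))"
        using Fh by eventually_elim (use s h in \<open>auto simp: indicator_def E_per\<close>)
    qed auto
    also have "\<dots> = (LINT t|lborel. indicat_real {0..s} t *\<^sub>R (F t * E k t))"
      by (subst lborel_integral_real_affine[of 1 _ h]) (auto simp: indicator_def)
    finally show ?thesis
      using split[of s h "s + h"] split[of 0 s h] s h by (simp add: J_def)
  qed
  have J_shift: "\<exists>g. \<forall>k. J k 0 = g * E k s * J k 0" if s: "0 \<le> s" "s \<le> h" for s
  proof -
    obtain g where g: "AE t in lborel. t \<in> {s..T} \<longrightarrow> F t = g * F (t - s)" using Fs[OF s] by blast
    have "J k 0 = g * E k s * J k 0" for k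
    proof -
      have "J k 0 = J k s" using J_periodic[OF s] by simp
      also have "\<dots> = (LINT t|lborel. g * E k s * (indicat_real {s..s + h} t *\<^sub>R (F (t - s) * E k (t - s))))"
        unfolding J_def
      proof (rule integral_cong_AE)
        show "AE t in lborel. indicat_real {s..s + h} t *\<^sub>R (F t * E k t) =
           g * E k s * (indicat_real {s..s + h} t *\<^sub>R (F (t - s) * E k (t - s)))"
          using g
        proof eventually_elim
          case (elim t)
          show ?case using elim E_add[of k s "t - s"] s h by (auto simp: indicator_def mult_ac)
        qed
      qed auto
      also have "\<dots> = g * E k s * (LINT t|lborel. indicat_real {s..s + h} t *\<^sub>R (F (t - s) * E k (t - s)))"
        by (rule integral_mult_right_zero)
      also have "(LINT t|lborel. indicat_real {s..s + h} t *\<^sub>R (F (t - s) * E k (t - s))) = J k 0"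
        unfolding J_def by (subst lborel_integral_real_affine[of 1 _ s]) (auto simp: indicator_def)
      finally show ?thesis .
    qed
    then show ?thesis by blast
  qed
  have J_unique: "k = l" if "J k 0 \<noteq> 0" "J l 0 \<noteq> 0" for k l
  proof (rule ccontr)
    assume "k \<noteq> l"
    \<comment> \<open>At this shift the characters \<open>E k\<close> and \<open>E l\<close> differ
      by the factor \<open>E (k - l) s = -1\<close>, whereas two nonzero coefficients would make
      them equal.\<close>
    define s where "s = h / (2 * \<bar>of_int (k - l)\<bar>)"
    have 1: "1 \<le> \<bar>of_int (k - l) :: real\<bar>" using \<open>k \<noteq> l\<close> by linarith
    have "s \<le> h / 1" unfolding s_def using 1 h by (intro divide_left_mono) auto
    then have s: "0 \<le> s" "s \<le> h" using h by (auto simp: s_def)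
    obtain g where "\<forall>k. J k 0 = g * E k s * J k 0" using J_shift[OF s] by blast
    then have "g * E k s = 1" "g * E l s = 1" using that by (metis mult_cancel_right1)+
    then have "E k s = E l s" by (metis mult_cancel_left zero_neq_one mult_zero_left)
    moreover have "E k s = E (k - l) s * E l s" using E_mult[of "k - l" l s] by simp
    ultimately have "E (k - l) s = 1" by (simp add: E_def)
    moreover have "of_int (k - l) * (2 * pi / h * s) = pi \<or> of_int (k - l) * (2 * pi / h * s) = - pi"
      using 1 h unfolding s_def by (cases "k > l") (auto simp: field_simps)
    ultimately show False by (auto simp: E_def complex_eq_iff)
  qed
  obtain k0 where k0: "\<And>k. k \<noteq> k0 \<Longrightarrow> J k 0 = 0" using J_unique by metis
  define H where "H t = indicat_real {0..h} t *\<^sub>R (F t * E k0 t)" for t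
  have "AE t in lborel. t \<in> {0..h} \<longrightarrow> H t = (LINT t|lborel. H t) / of_real (h - 0)"
  proof (rule AE_const_if_fourier_series_zero)
    show "integrable lborel H" unfolding H_def using intG h by auto
    show "AE t in lborel. t \<notin> {0..h} \<longrightarrow> H t = 0" by (auto simp: H_def)
    fix k :: int assume "k \<noteq> 0"
    have "(LINT t|lborel. H t * cis (of_int k * (2 * pi / (h - 0) * t))) = J (k0 + k) 0"
      unfolding J_def H_def E_mult by (simp add: E_def mult.assoc)
    then show "(LINT t|lborel. H t * cis (of_int k * (2 * pi / (h - 0) * t))) = 0" using k0 \<open>k \<noteq> 0\<close> by simp
  qed (use h in auto)
  then obtain \<alpha> where \<alpha>: "AE t in lborel. t \<in> {0..h} \<longrightarrow> H t = \<alpha>" by blast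
  have E_inv: "E k0 t * E (- k0) t = 1" for t using E_mult[of k0 "- k0" t] by (simp add: E_def)
  have F0: "AE t in lborel. t \<in> {0..h} \<longrightarrow> F t = \<alpha> * E (- k0) t"
    using \<alpha>
  proof eventually_elim
    case (elim t)
    show ?case
    proof
      assume "t \<in> {0..h}"
      then have "F t * E k0 t = \<alpha>" using elim by (simp add: H_def)
      then show "F t = \<alpha> * E (- k0) t" using E_inv[of t] by (auto simp: mult.assoc)
    qed
  qed
  have "AE t in lborel. - h + 1 * t \<in> {0..h} \<longrightarrow> F (- h + 1 * t) = \<alpha> * E (- k0) (- h + 1 * t)"
    by (rule AE_lborel_affine[OF F0]) simp
  with F0 Fh have "AE t in lborel. t \<in> {0..T} \<longrightarrow> F t = \<alpha> * E (- k0) t"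
  proof eventually_elim
    case (elim t)
    show ?case
    proof
      assume t: "t \<in> {0..T}"
      show "F t = \<alpha> * E (- k0) t"
      proof (cases "t \<le> h")
        case True then show ?thesis using elim t by simp
      next
        case False
        have "- h + 1 * t = t - h" by simp
        then show ?thesis using elim t False h E_per[of "- k0" t] by simp
      qed
    qed
  qed
  then have "AE t in lborel. t \<in> {0..T} \<longrightarrow> f t = \<alpha> * cis ((\<beta> - of_int k0 * (2 * pi / h)) * t)"
  proof eventually_elim
    case (elim t)
    have "f t = F t * cis (\<beta> * t)" by (simp add: F_def mult.assoc cis_mult)
    moreover have "E (- k0) t * cis (\<beta> * t) = cis ((\<beta> - of_int k0 * (2 * pi / h)) * t)"
      by (simp add: E_def cis_mult algebra_simps)
    ultimately show ?case using elim by (simp add: mult.assoc)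
  qed
  then show ?thesis by blast
qed

section \<open>Pulse signals\<close>

lemma mset2_eqD:
  assumes "{#a, b#} = {#c, d#}"
  shows "a = c \<and> b = d \<or> a = d \<and> b = c"
proof -
  have "a \<in># {#c, d#}" unfolding assms[symmetric] by simp
  then consider "a = c" | "a = d" by auto
  then show ?thesis
  proof cases
    case 2
    then have "{#a, b#} = {#a, c#}" using assms by (simp add: add_mset_commute)
    then show ?thesis using 2 by simp
  qed (use assms in simp)
qed

lemma mset3_eqD:
  assumes "{#a, b, c#} = {#d, e, f#}"
  shows "a = d \<and> {#b, c#} = {#e, f#} \<or> a = e \<and> {#b, c#} = {#d, f#} \<or> a = f \<and> {#b, c#} = {#d, e#}"
proof -
  have "a \<in># {#d, e, f#}" unfolding assms[symmetric] by simp
  moreover have "{#b, c#} = {#a, b, c#} - {#a#}" by simp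
  then have "{#b, c#} = {#d, e, f#} - {#a#}" unfolding assms .
  ultimately show ?thesis by (auto simp: add_mset_commute)
qed

lemma B2_setD:
  assumes "B2_set \<Lambda>" "a \<in> \<Lambda>" "b \<in> \<Lambda>" "c \<in> \<Lambda>" "d \<in> \<Lambda>" "a + b = c + d"
  shows "a = c \<and> b = d \<or> a = d \<and> b = c"
proof -
  have "a + b \<in> \<Lambda> + \<Lambda>" using assms by (intro set_plus_intro)
  then have "\<exists>!M. \<exists>n1\<in>\<Lambda>. \<exists>n2\<in>\<Lambda>. M = {#n1, n2#} \<and> a + b = n1 + n2"
    using assms(1) by (auto simp: B2_set_def)
  then have "{#a, b#} = {#c, d#}" using assms(2-6) by blast
  then show ?thesis by (rule mset2_eqD)
qed

lemma B3_setD: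
  assumes "B3_set \<Lambda>" "a \<in> \<Lambda>" "b \<in> \<Lambda>" "c \<in> \<Lambda>" "d \<in> \<Lambda>" "e \<in> \<Lambda>" "f \<in> \<Lambda>" "a + b + c = d + e + f"
  shows "{#a, b, c#} = {#d, e, f#}"
proof -
  have "a + b + c \<in> \<Lambda> + \<Lambda> + \<Lambda>" using assms by (intro set_plus_intro)
  then have "\<exists>!M. \<exists>n1\<in>\<Lambda>. \<exists>n2\<in>\<Lambda>. \<exists>n3\<in>\<Lambda>. M = {#n1, n2, n3#} \<and> a + b + c = n1 + n2 + n3"
    using assms(1) by (auto simp: B3_set_def)
  then show ?thesis using assms(2-8) by blast
qed

lemma pulse_signal_eq:
  assumes "T < 1"
  shows "pulse_signal \<Lambda> T c t = (if \<lfloor>t\<rfloor> \<in> \<Lambda> \<and> t \<le> of_int \<lfloor>t\<rfloor> + T then c \<lfloor>t\<rfloor> else 0)"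
proof -
  have "pulse_signal \<Lambda> T c t
      = (\<Sum>\<^sub>\<infinity>j\<in>\<Lambda> \<inter> {\<lfloor>t\<rfloor>}. c j * indicator {real_of_int j..real_of_int j + T} t)"
    unfolding pulse_signal_def
  proof (rule infsum_cong_neutral)
    fix j assume "j \<in> \<Lambda> - \<Lambda> \<inter> {\<lfloor>t\<rfloor>}"
    then have "j \<noteq> \<lfloor>t\<rfloor>" by auto
    then have "t \<notin> {real_of_int j..real_of_int j + T}" using assms floor_unique[of j t] by fastforce
    then show "c j * indicator {real_of_int j..real_of_int j + T} t = 0" by simp
  qed auto
  also have "\<dots> = (if \<lfloor>t\<rfloor> \<in> \<Lambda> \<and> t \<le> of_int \<lfloor>t\<rfloor> + T then c \<lfloor>t\<rfloor> else 0)"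
    by (cases "\<lfloor>t\<rfloor> \<in> \<Lambda>") (auto simp: indicator_def)
  finally show ?thesis .
qed

lemma pulse_signal_on_block:
  assumes "T < 1" "t \<in> {of_int j..of_int j + T}"
  shows "pulse_signal \<Lambda> T c t = (if j \<in> \<Lambda> then c j else 0)"
proof -
  have "\<lfloor>t\<rfloor> = j" using assms by (intro floor_unique) auto
  then show ?thesis using assms by (simp add: pulse_signal_eq)
qed

lemma pulse_signal_nonzeroE:
  assumes "T < 1" "pulse_signal \<Lambda> T c t \<noteq> 0"
  obtains j where "j \<in> \<Lambda>" "c j \<noteq> 0" "t \<in> {of_int j..of_int j + T}" "pulse_signal \<Lambda> T c t = c j"
  using assms(2) that[of "\<lfloor>t\<rfloor>"] of_int_floor_le[of t]
  unfolding pulse_signal_eq[OF assms(1)] by (auto split: if_splits)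

lemma pulse_signal_measurable [measurable]:
  assumes "T < 1"
  shows "pulse_signal \<Lambda> T c \<in> borel_measurable borel"
proof -
  have *: "(\<lambda>t::real. c \<lfloor>t\<rfloor>) \<in> borel_measurable borel"
    by (rule measurable_compose[OF measurable_real_floor]) auto
  have "(\<lambda>t::real. if \<lfloor>t\<rfloor> \<in> \<Lambda> \<and> t \<le> of_int \<lfloor>t\<rfloor> + T then c \<lfloor>t\<rfloor> else 0) \<in> borel_measurable borel"
    using * by measurable
  then show ?thesis using pulse_signal_eq[OF assms, of \<Lambda> c] by (subst measurable_cong) auto
qed

lemma pulse_signal_in_L2:
  assumes T: "0 < T" "T < 1" and c: "(\<lambda>j. (cmod (c j))\<^sup>2) summable_on \<Lambda>"
  shows "pulse_signal \<Lambda> T c \<in> L2"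
proof -
  have [measurable]: "pulse_signal \<Lambda> T c \<in> borel_measurable borel" using T by simp
  \<comment> \<open>The integers are enumerated and indices outside \<open>\<Lambda>\<close> get
    weight 0, so that sum and integral can be exchanged along a sequence.\<close>
  define b where "b n = (if int_decode n \<in> \<Lambda> then (cmod (c (int_decode n)))\<^sup>2 else 0)" for n
  define B where "B n = {real_of_int (int_decode n)..real_of_int (int_decode n) + T}" for n
  have b: "summable b"
  proof -
    have "(\<lambda>j. if j \<in> \<Lambda> then (cmod (c j))\<^sup>2 else 0) summable_on UNIV"
      using c summable_on_cong_neutral[of UNIV \<Lambda> "\<lambda>j. if j \<in> \<Lambda> then (cmod (c j))\<^sup>2 else 0" "\<lambda>j. (cmod (c j))\<^sup>2"] by simp
    then have "((\<lambda>j. if j \<in> \<Lambda> then (cmod (c j))\<^sup>2 else 0) \<circ> int_decode) summable_on UNIV"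
      by (subst summable_on_reindex[symmetric]) (auto simp: bij_int_decode bij_is_surj bij_is_inj)
    moreover have "(\<lambda>j. if j \<in> \<Lambda> then (cmod (c j))\<^sup>2 else 0) \<circ> int_decode = b"
      by (auto simp: b_def)
    ultimately have "b summable_on UNIV" by simp
    then show ?thesis by (rule summable_on_UNIV_nonneg_real_iff[THEN iffD1, rotated]) (simp add: b_def)
  qed
  have "(\<integral>\<^sup>+t. ennreal ((cmod (pulse_signal \<Lambda> T c t))\<^sup>2) \<partial>lborel)
      \<le> (\<integral>\<^sup>+t. (\<Sum>n. ennreal (b n) * indicator (B n) t) \<partial>lborel)"
  proof (rule nn_integral_mono)
    fix t
    show "ennreal ((cmod (pulse_signal \<Lambda> T c t))\<^sup>2) \<le> (\<Sum>n. ennreal (b n) * indicator (B n) t)"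
    proof (cases "pulse_signal \<Lambda> T c t = 0")
      case False
      then obtain j where j: "j \<in> \<Lambda>" "t \<in> {of_int j..of_int j + T}" "pulse_signal \<Lambda> T c t = c j"
        using pulse_signal_nonzeroE[OF T(2)] by metis
      have "ennreal ((cmod (pulse_signal \<Lambda> T c t))\<^sup>2) = ennreal (b (int_encode j)) * indicator (B (int_encode j)) t"
        using j by (simp add: b_def B_def)
      also have "\<dots> \<le> (\<Sum>n. ennreal (b n) * indicator (B n) t)"
        using sum_le_suminf[OF summableI, of "{int_encode j}" "\<lambda>n. ennreal (b n) * indicator (B n) t"]
        by (simp only: finite.intros sum.insert sum.empty empty_iff add_0_right not_False_eq_True zero_le simp_thms ball_simps)
      finally show ?thesis .
    qed simp
  qed
  also have "\<dots> = (\<Sum>n. \<integral>\<^sup>+t. ennreal (b n) * indicator (B n) t \<partial>lborel)"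
    by (rule nn_integral_suminf) (simp add: B_def)
  also have "\<dots> = (\<Sum>n. ennreal (b n) * ennreal T)"
    using T by (intro suminf_cong) (simp add: B_def nn_integral_cmult_indicator)
  also have "\<dots> = ennreal (\<Sum>n. b n) * ennreal T"
    using b by (subst suminf_ennreal2[symmetric]) (auto simp: b_def)
  also have "\<dots> < \<infinity>" by (simp add: ennreal_mult_less_top)
  finally show ?thesis by (simp add: L2_def integrable_iff_bounded)
qed

text \<open>Pulses have length at most \<open>1/2\<close>, so up to null sets a shift \<open>x\<close> makes overlap only pairs of
  pulses with one and the same difference of positions, which by the \<open>B\<^sub>2\<close> property is a single pair
  when that difference is not \<open>0\<close>.\<close>

lemma ambiguity_partners_pulse_signal_phases:
  fixes \<omega> :: "int \<Rightarrow> real"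
  assumes T: "0 < T" "T \<le> 1 / 2" and c: "(\<lambda>j. (cmod (c j))\<^sup>2) summable_on \<Lambda>"
    and B2: "B2_set \<Lambda>"
  shows "ambiguity_partners (pulse_signal \<Lambda> T c) (pulse_signal \<Lambda> T (\<lambda>j. cis (\<omega> j) * c j))"
proof -
  define u where "u = pulse_signal \<Lambda> T c"
  define v where "v = pulse_signal \<Lambda> T (\<lambda>j. cis (\<omega> j) * c j)"
  have T1: "T < 1" using T by simp
  have u: "u \<in> L2" and v: "v \<in> L2"
    unfolding u_def v_def by (intro pulse_signal_in_L2 T T1, simp add: norm_mult c)+
  have [measurable]: "u \<in> borel_measurable borel" "v \<in> borel_measurable borel"
    using u v by (auto intro: L2_measurable)
  have vu: "v t = cis (\<omega> \<lfloor>t\<rfloor>) * u t" for t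
    using T1 by (simp add: u_def v_def pulse_signal_eq)
  have "cmod (ambiguity u x y) = cmod (ambiguity v x y)" for x y
  proof -
    \<comment> \<open>Pulse endpoints: for \<open>T = 1 / 2\<close> they can realize two different
      differences at the same \<open>x\<close>. Away from them, \<open>x\<close> differs from the
      index difference by less than \<open>T\<close>, which leaves room for one integer
      only.\<close>
    define E where "E = (\<Union>z::int. {of_int z, of_int z + T :: real})"
    define Q where "Q t \<longleftrightarrow> t \<notin> E \<and> u t \<noteq> 0 \<and> u (t - x) \<noteq> 0" for t
    have "countable E" unfolding E_def by auto
    then have AE_E: "AE t in lborel. t \<notin> E"
      by (intro AE_not_in countable_imp_null_set_lborel)
    have same: "\<lfloor>t\<rfloor> - \<lfloor>t - x\<rfloor> = \<lfloor>t'\<rfloor> - \<lfloor>t' - x\<rfloor>" if "Q t" "Q t'" for t t'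
    proof -
      have *: "of_int \<lfloor>t\<rfloor> < t \<and> t < of_int \<lfloor>t\<rfloor> + T \<and> of_int \<lfloor>t - x\<rfloor> \<le> t - x \<and> t - x \<le> of_int \<lfloor>t - x\<rfloor> + T"
        if "Q t" for t
      proof -
        have "t \<noteq> of_int \<lfloor>t\<rfloor>" "t \<noteq> of_int \<lfloor>t\<rfloor> + T" using that unfolding Q_def E_def by auto
        moreover have "t \<le> of_int \<lfloor>t\<rfloor> + T" "t - x \<le> of_int \<lfloor>t - x\<rfloor> + T"
          using that T1 by (auto simp: Q_def u_def pulse_signal_eq split: if_splits)
        moreover have "of_int \<lfloor>t\<rfloor> \<le> t" "of_int \<lfloor>t - x\<rfloor> \<le> t - x" by (rule of_int_floor_le)+
        ultimately show ?thesis by linarith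
      qed
      have "\<bar>of_int (\<lfloor>t\<rfloor> - \<lfloor>t - x\<rfloor>) - of_int (\<lfloor>t'\<rfloor> - \<lfloor>t' - x\<rfloor>)\<bar> < (1::real)"
        using *[OF that(1)] *[OF that(2)] T(2) unfolding of_int_diff abs_less_iff by linarith
      then show ?thesis by linarith
    qed
    have mem: "\<lfloor>t\<rfloor> \<in> \<Lambda>" "\<lfloor>t - x\<rfloor> \<in> \<Lambda>" if "Q t" for t
      using that T1 by (auto simp: Q_def u_def pulse_signal_eq split: if_splits)
    have "\<exists>\<zeta>. cmod \<zeta> = 1 \<and> (\<forall>t. Q t \<longrightarrow> cis (\<omega> \<lfloor>t\<rfloor>) * cnj (cis (\<omega> \<lfloor>t - x\<rfloor>)) = \<zeta>)"
    proof (cases "\<exists>t. Q t")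
      case True
      then obtain t0 where t0: "Q t0" by blast
      have "cis (\<omega> \<lfloor>t\<rfloor>) * cnj (cis (\<omega> \<lfloor>t - x\<rfloor>)) = cis (\<omega> \<lfloor>t0\<rfloor>) * cnj (cis (\<omega> \<lfloor>t0 - x\<rfloor>))" if t: "Q t" for t
      proof -
        have "\<lfloor>t\<rfloor> + \<lfloor>t0 - x\<rfloor> = \<lfloor>t0\<rfloor> + \<lfloor>t - x\<rfloor>" using same[OF t t0] by simp
        \<comment> \<open>Either both points see the same pair of pulses, or the difference is 0 and
          the two phases cancel at each of them.\<close>
        then have "\<lfloor>t\<rfloor> = \<lfloor>t0\<rfloor> \<and> \<lfloor>t0 - x\<rfloor> = \<lfloor>t - x\<rfloor> \<or> \<lfloor>t\<rfloor> = \<lfloor>t - x\<rfloor> \<and> \<lfloor>t0 - x\<rfloor> = \<lfloor>t0\<rfloor>"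
          using mem[OF t] mem[OF t0] by (intro B2_setD[OF B2])
        then show ?thesis by (auto simp: cis_cnj cis_mult)
      qed
      then show ?thesis by (intro exI[of _ "cis (\<omega> \<lfloor>t0\<rfloor>) * cnj (cis (\<omega> \<lfloor>t0 - x\<rfloor>))"]) (auto simp: norm_mult)
    qed (auto intro: exI[of _ 1])
    then obtain \<zeta> where \<zeta>: "cmod \<zeta> = 1" "\<And>t. Q t \<Longrightarrow> cis (\<omega> \<lfloor>t\<rfloor>) * cnj (cis (\<omega> \<lfloor>t - x\<rfloor>)) = \<zeta>" by blast
    have "ambiguity v x y = (LINT t|lborel. \<zeta> * (u t * cnj (u (t - x)) * cis (y * t)))"
      unfolding ambiguity_def
    proof (rule integral_cong_AE)
      show "AE t in lborel. v t * cnj (v (t - x)) * cis (y * t) = \<zeta> * (u t * cnj (u (t - x)) * cis (y * t))"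
        using AE_E
      proof eventually_elim
        case (elim t)
        have eq: "v t * cnj (v (t - x)) = (cis (\<omega> \<lfloor>t\<rfloor>) * cnj (cis (\<omega> \<lfloor>t - x\<rfloor>))) * (u t * cnj (u (t - x)))"
          unfolding vu complex_cnj_mult by (simp only: mult_ac)
        show ?case
        proof (cases "Q t")
          case True
          show ?thesis unfolding eq \<zeta>(2)[OF True] by (simp only: mult.assoc)
        next
          case False
          then have "u t = 0 \<or> u (t - x) = 0" using elim by (simp add: Q_def)
          then show ?thesis unfolding eq by auto
        qed
      qed
    qed auto
    then show ?thesis using \<zeta>(1) by (simp add: ambiguity_def norm_mult)
  qed
  then show ?thesis using u v by (simp add: ambiguity_partners_def u_def v_def)
qed

section \<open>Partners of a pulse signal over a finite \<open>B\<^sub>3\<close>-set\<close>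

text \<open>Adding the same element of \<open>\<Lambda>\<close> to two equal sums of pairs gives
  equal sums of triples.\<close>

lemma B3_set_imp_B2_set:
  assumes "B3_set \<Lambda>" shows "B2_set \<Lambda>"
  unfolding B2_set_def
proof
  fix n assume "n \<in> \<Lambda> + \<Lambda>"
  then obtain a b where ab: "a \<in> \<Lambda>" "b \<in> \<Lambda>" "n = a + b" by (rule set_plus_elim)
  show "\<exists>!M. \<exists>n1\<in>\<Lambda>. \<exists>n2\<in>\<Lambda>. M = {#n1, n2#} \<and> n = n1 + n2"
  proof (rule ex1I[of _ "{#a, b#}"])
    fix M assume "\<exists>n1\<in>\<Lambda>. \<exists>n2\<in>\<Lambda>. M = {#n1, n2#} \<and> n = n1 + n2"
    then obtain n1 n2 where n: "n1 \<in> \<Lambda>" "n2 \<in> \<Lambda>" "M = {#n1, n2#}" "n = n1 + n2" by blast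
    have "{#a, n1, n2#} = {#a, a, b#}"
      by (rule B3_setD[OF assms]) (use ab n in auto)
    then have "{#n1, n2#} = {#a, b#}" by (simp only: add_mset_add_mset_same_iff)
    then show "M = {#a, b#}" using n by simp
  qed (use ab in blast)
qed

lemma B3_set_subset:
  assumes "B3_set \<Lambda>" "\<Lambda>' \<subseteq> \<Lambda>" shows "B3_set \<Lambda>'"
  unfolding B3_set_def
proof
  fix n assume "n \<in> \<Lambda>' + \<Lambda>' + \<Lambda>'"
  then obtain a b d where ab: "a \<in> \<Lambda>'" "b \<in> \<Lambda>'" "d \<in> \<Lambda>'" "n = a + b + d" by (elim set_plus_elim) auto
  show "\<exists>!M. \<exists>n1\<in>\<Lambda>'. \<exists>n2\<in>\<Lambda>'. \<exists>n3\<in>\<Lambda>'. M = {#n1, n2, n3#} \<and> n = n1 + n2 + n3"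
  proof (rule ex1I[of _ "{#a, b, d#}"])
    fix M assume "\<exists>n1\<in>\<Lambda>'. \<exists>n2\<in>\<Lambda>'. \<exists>n3\<in>\<Lambda>'. M = {#n1, n2, n3#} \<and> n = n1 + n2 + n3"
    then obtain n1 n2 n3 where n: "n1 \<in> \<Lambda>'" "n2 \<in> \<Lambda>'" "n3 \<in> \<Lambda>'" "M = {#n1, n2, n3#}" "n = n1 + n2 + n3" by blast
    have "{#n1, n2, n3#} = {#a, b, d#}"
      by (rule B3_setD[OF assms(1)]) (use ab n assms(2) in auto)
    then show "M = {#a, b, d#}" using n by simp
  qed (use ab in blast)
qed

lemma AE_on_interval_witness:
  fixes p q :: real
  assumes "AE t in lborel. t \<in> {p..q} \<longrightarrow> P t" "p < q"
  shows "\<exists>t\<in>{p..q}. P t"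
proof (rule ccontr)
  assume "\<not> ?thesis"
  then have "AE t in lborel. t \<notin> {p..q}" using assms(1) by (auto elim: eventually_mono)
  then have "{p..q} \<in> null_sets lborel" by (subst (asm) AE_iff_null_sets[symmetric]) auto
  then show False using assms(2) by (auto simp: null_sets_def)
qed

abbreviation block :: "real \<Rightarrow> int \<Rightarrow> real set" where
  "block T k \<equiv> {of_int k..of_int k + T}"

text \<open>Nonzero coefficients make \<open>Min \<Lambda>\<close> and \<open>Max \<Lambda>\<close>
  the positions of the actual outermost pulses of the signal.\<close>

locale B3_pulse =
  fixes \<Lambda> :: "int set" and c :: "int \<Rightarrow> complex" and T :: real
  assumes finite_pos: "finite \<Lambda>" and nonempty: "\<Lambda> \<noteq> {}"
    and coeff_nonzero: "j \<in> \<Lambda> \<Longrightarrow> c j \<noteq> 0"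
    and B3: "B3_set \<Lambda>"
    and T_pos: "0 < T" and T_le: "T \<le> 1 / 2"
begin

definition "u = pulse_signal \<Lambda> T c"
definition "m = Min \<Lambda>"
definition "M = Max \<Lambda>"

definition partner :: "(real \<Rightarrow> complex) \<Rightarrow> bool" where
  "partner v \<longleftrightarrow> v \<in> L2 \<and> (\<forall>x y. cmod (ambiguity v x y) = cmod (ambiguity u x y))"

lemma T_less_1: "T < 1" using T_le by simp

lemma m_mem: "m \<in> \<Lambda>" and M_mem: "M \<in> \<Lambda>"
  using finite_pos nonempty by (auto simp: m_def M_def)

lemma m_le: "j \<in> \<Lambda> \<Longrightarrow> m \<le> j" and M_ge: "j \<in> \<Lambda> \<Longrightarrow> j \<le> M"
  using finite_pos by (auto simp: m_def M_def)

lemma u_measurable [measurable]: "u \<in> borel_measurable borel"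
  unfolding u_def using T_less_1 by (rule pulse_signal_measurable)

lemma partnerD:
  assumes "partner v"
  shows "v \<in> L2" "v \<in> borel_measurable borel" "cmod (ambiguity v x y) = cmod (ambiguity u x y)"
proof -
  show "v \<in> L2" using assms by (simp add: partner_def)
  then show "v \<in> borel_measurable borel" by (rule L2_measurable)
  show "cmod (ambiguity v x y) = cmod (ambiguity u x y)" using assms by (simp add: partner_def)
qed

lemma partner_transform:
  fixes \<epsilon> \<theta> b a :: real
  assumes "partner v" "\<epsilon> \<in> {-1, 1}"
  defines "v' \<equiv> \<lambda>t. cis (\<theta> + b * t) * v (\<epsilon> * t - a)"
  shows "partner v'" "trivial_transform v v'"
proof -
  show tt: "trivial_transform v v'" unfolding v'_def by (rule trivial_transform_affine[OF assms(2)])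
  have L2: "v' \<in> L2" unfolding v'_def by (rule L2_affine) (use assms in \<open>auto simp: partner_def\<close>)
  show "partner v'"
    using cmod_ambiguity_trivial_transform[OF tt partnerD(2)[OF assms(1)] L2_measurable[OF L2]] L2
      partnerD(3)[OF assms(1)] by (simp add: partner_def)
qed

lemma difference_unique:
  assumes "j \<in> \<Lambda>" "k \<in> \<Lambda>" "j' \<in> \<Lambda>" "k' \<in> \<Lambda>" "j - k = j' - k'" "j \<noteq> k"
  shows "j = j' \<and> k = k'"
proof -
  have "j + k' = j' + k" using assms by simp
  then have "j = j' \<and> k' = k \<or> j = k \<and> k' = j'"
    using assms by (intro B2_setD[OF B3_set_imp_B2_set[OF B3]])
  then show ?thesis using assms by auto
qed

section \<open>Confinement and normalization of a partner\<close>

text \<open>If \<open>x\<close> is at distance at least \<open>T\<close> from \<open>j - k\<close>,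
  pulse \<open>j\<close> and the shifted pulse \<open>k\<close> meet at most in an endpoint. So the
  product for \<open>u\<close> vanishes off a finite set, and the zero passes to \<open>v\<close>
  through the Fourier transform.\<close>

lemma product_zero_if_no_difference_near:
  assumes v: "partner v" and far: "\<And>j k. j \<in> \<Lambda> \<Longrightarrow> k \<in> \<Lambda> \<Longrightarrow> T \<le> \<bar>x - of_int (j - k)\<bar>"
  shows "AE t in lborel. v t * cnj (v (t - x)) = 0"
proof (rule AE_product_zero_if_ambiguity_zero[OF partnerD(1)[OF v]])
  fix y
  have "finite (\<Union>j\<in>\<Lambda>. {of_int j, of_int j + T :: real})" using finite_pos by auto
  then have "AE t in lborel. t \<notin> (\<Union>j\<in>\<Lambda>. {of_int j, of_int j + T :: real})"
    by (intro AE_not_in finite_imp_null_set_lborel)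
  then have "AE t in lborel. u t * cnj (u (t - x)) * cis (y * t) = 0"
  proof eventually_elim
    case (elim t)
    show ?case
    proof (rule ccontr)
      assume "\<not> ?case"
      then have "u t \<noteq> 0" "u (t - x) \<noteq> 0" by auto
      then obtain j k where jk: "j \<in> \<Lambda>" "t \<in> block T j" "k \<in> \<Lambda>" "t - x \<in> block T k"
        unfolding u_def by (metis pulse_signal_nonzeroE[OF T_less_1])
      then have "t \<noteq> of_int j" "t \<noteq> of_int j + T" using elim by auto
      then show False using jk far[of j k] by (auto simp: abs_real_def split: if_splits)
    qed
  qed
  then have "ambiguity u x y = 0" unfolding ambiguity_def by (rule integral_eq_zero_AE)
  then show "ambiguity v x y = 0" using partnerD(3)[OF v, of x y] by simp
qed

lemma partner_supported:
  assumes v: "partner v"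
  shows "\<exists>v'. trivial_transform v v' \<and> partner v' \<and> (AE t in lborel. t \<notin> {of_int m..of_int M + T} \<longrightarrow> v' t = 0)"
proof -
  define D where "D = of_int M + T - of_int m"
  have D: "D \<ge> 0" using m_le[OF M_mem] T_pos by (simp add: D_def)
  have "AE t in lborel. v t * cnj (v (t - x)) = 0" if "x > D" for x
  proof (rule product_zero_if_no_difference_near[OF v])
    fix j k assume "j \<in> \<Lambda>" "k \<in> \<Lambda>"
    then have "of_int j \<le> real_of_int M" "of_int m \<le> real_of_int k" using m_le M_ge by auto
    then show "T \<le> \<bar>x - of_int (j - k)\<bar>" using that by (simp add: D_def)
  qed
  then obtain a where a: "AE t in lborel. t \<notin> {a..a + D} \<longrightarrow> v t = 0"
    using AE_supported_in_interval[OF partnerD(2)[OF v] D] by blast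
  define v' where "v' = (\<lambda>t. cis (0 + 0 * t) * v (1 * t - (of_int m - a)))"
  have "AE t in lborel. a - of_int m + 1 * t \<notin> {a..a + D} \<longrightarrow> v (a - of_int m + 1 * t) = 0"
    by (rule AE_lborel_affine[OF a]) simp
  then have "AE t in lborel. t \<notin> {of_int m..of_int M + T} \<longrightarrow> v' t = 0"
  proof eventually_elim
    case (elim t)
    have "v' t = v (a - of_int m + 1 * t)" by (simp add: v'_def algebra_simps)
    then show ?case using elim by (auto simp: D_def)
  qed
  then show ?thesis using partner_transform[OF v, of 1 0 0 "of_int m - a"] unfolding v'_def by blast
qed

text \<open>Write \<open>p\<close> and \<open>q\<close> for \<open>v\<close> on the two extreme
  blocks. The product of \<open>p\<close> with the conjugate of \<open>q\<close> shifted by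
  \<open>s\<close> is a constant whose modulus does not depend on \<open>s\<close>. Comparison with
  the shift 0 eliminates \<open>q\<close>: a shift multiplies \<open>p\<close> by a unimodular
  constant.\<close>

lemma extreme_blocks_exponential:
  assumes v: "partner v" and supp: "AE t in lborel. t \<notin> {of_int m..of_int M + T} \<longrightarrow> v t = 0"
  shows "\<exists>\<beta> \<alpha>m \<alpha>M. cmod (\<alpha>m * \<alpha>M) = cmod (c m * c M) \<and>
    (AE t in lborel. t \<in> block T m \<longrightarrow> v t = \<alpha>m * cis (\<beta> * t)) \<and>
    (AE t in lborel. t \<in> block T M \<longrightarrow> v t = \<alpha>M * cis (\<beta> * t))"
proof -
  note [measurable] = partnerD(2)[OF v]
  define p q where "p r = v (of_int M + r)" and "q r = v (of_int m + r)" for r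
  have pq: "\<exists>\<gamma>. cmod \<gamma> = cmod (c m * c M) \<and> (AE r in lborel. r \<in> {s..T} \<longrightarrow> p r * cnj (q (r - s)) = \<gamma>)"
    if s: "0 \<le> s" "s < T" for s
  proof -
    \<comment> \<open>At this shift the whole support interval meets its translate exactly in the
      last \<open>T - s\<close> of block \<open>M\<close>, so no other part of \<open>v\<close>
      interferes.\<close>
    define x where "x = of_int M - of_int m + s"
    have "\<exists>\<gamma>. cmod \<gamma> = cmod (c M * cnj (c m)) \<and>
      (AE t in lborel. t \<in> {of_int M + s..of_int M + T} \<longrightarrow> v t * cnj (v (t - x)) = \<gamma>)"
    proof (rule AE_product_const_if_ambiguity[OF u_measurable partnerD(1)[OF v] _ _ partnerD(3)[OF v]])
      have "AE t in lborel. - x + 1 * t \<notin> {of_int m..of_int M + T} \<longrightarrow> v (- x + 1 * t) = 0"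
        by (rule AE_lborel_affine[OF supp]) simp
      with supp show "AE t in lborel. t \<notin> {of_int M + s..of_int M + T} \<longrightarrow> v t * cnj (v (t - x)) = 0"
      proof eventually_elim
        case (elim t)
        have "- x + 1 * t = t - x" by simp
        moreover have "t \<notin> {of_int m..of_int M + T} \<or> t - x \<notin> {of_int m..of_int M + T}"
          if "t \<notin> {of_int M + s..of_int M + T}" using that by (auto simp: x_def)
        ultimately show ?case using elim by auto
      qed
      have "u t * cnj (u (t - x)) = c M * cnj (c m) * indicator {of_int M + s..of_int M + T} t" for t
      proof (cases "t \<in> {of_int M + s..of_int M + T}")
        case True
        then have "t \<in> block T M" "t - x \<in> block T m" using s by (auto simp: x_def)
        then show ?thesis using True m_mem M_mem by (simp add: u_def pulse_signal_on_block[OF T_less_1])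
      next
        case False
        have "u t = 0 \<or> u (t - x) = 0"
        proof (rule ccontr)
          assume "\<not> ?thesis"
          then obtain j k where jk: "j \<in> \<Lambda>" "t \<in> block T j" "k \<in> \<Lambda>" "t - x \<in> block T k"
            unfolding u_def by (metis pulse_signal_nonzeroE[OF T_less_1])
          then have "of_int j \<le> real_of_int M" "of_int m \<le> real_of_int k" using m_le M_ge by auto
          then show False using jk False by (auto simp: x_def)
        qed
        then show ?thesis using False by auto
      qed
      then show "AE t in lborel. u t * cnj (u (t - x)) = c M * cnj (c m) * indicator {of_int M + s..of_int M + T} t"
        by simp
    qed (use s in auto)
    then obtain \<gamma> where \<gamma>: "cmod \<gamma> = cmod (c M * cnj (c m))"
      "AE t in lborel. t \<in> {of_int M + s..of_int M + T} \<longrightarrow> v t * cnj (v (t - x)) = \<gamma>" by blast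
    have "AE r in lborel. of_int M + 1 * r \<in> {of_int M + s..of_int M + T} \<longrightarrow>
      v (of_int M + 1 * r) * cnj (v (of_int M + 1 * r - x)) = \<gamma>"
      by (rule AE_lborel_affine[OF \<gamma>(2)]) simp
    then have "AE r in lborel. r \<in> {s..T} \<longrightarrow> p r * cnj (q (r - s)) = \<gamma>"
    proof eventually_elim
      case (elim r)
      have eq: "of_int m + (r - s) = of_int M + r - x" by (simp add: x_def)
      show ?case using elim unfolding p_def q_def eq by simp
    qed
    then show ?thesis using \<gamma>(1) by (auto simp: norm_mult mult.commute)
  qed
  obtain \<gamma>0 where \<gamma>0: "cmod \<gamma>0 = cmod (c m * c M)" "AE r in lborel. r \<in> {0..T} \<longrightarrow> p r * cnj (q r) = \<gamma>0"
    using pq[of 0] T_pos by auto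
  have \<gamma>0_nz: "\<gamma>0 \<noteq> 0" using \<gamma>0(1) coeff_nonzero m_mem M_mem by (metis norm_eq_zero mult_eq_0_iff)
  have "\<exists>\<alpha> \<beta>. AE r in lborel. r \<in> {0..T} \<longrightarrow> p r = \<alpha> * cis (\<beta> * r)"
  proof (rule AE_exponential_if_shift_proportional[OF T_pos])
    have "p \<in> L2" using L2_affine[OF partnerD(1)[OF v], of 1 0 0 "- of_int M"] by (simp add: p_def[abs_def] add.commute)
    then show "integrable lborel (\<lambda>t. indicator {0..T} t * p t)" by (rule integrable_L2_interval)
    show "p \<in> borel_measurable borel" unfolding p_def by measurable
    fix s :: real assume s: "0 \<le> s" "s < T"
    obtain \<gamma> where \<gamma>: "cmod \<gamma> = cmod (c m * c M)" "AE r in lborel. r \<in> {s..T} \<longrightarrow> p r * cnj (q (r - s)) = \<gamma>"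
      using pq[OF s] by blast
    have "AE r in lborel. - s + 1 * r \<in> {0..T} \<longrightarrow> p (- s + 1 * r) * cnj (q (- s + 1 * r)) = \<gamma>0"
      by (rule AE_lborel_affine[OF \<gamma>0(2)]) simp
    with \<gamma>(2) have "AE r in lborel. r \<in> {s..T} \<longrightarrow> p r = \<gamma> / \<gamma>0 * p (r - s)"
    proof eventually_elim
      case (elim r)
      show ?case
      proof
        assume "r \<in> {s..T}"
        then have 1: "p r * cnj (q (r - s)) = \<gamma>" "p (r - s) * cnj (q (r - s)) = \<gamma>0"
          using elim s by auto
        then have "cnj (q (r - s)) \<noteq> 0" using \<gamma>0_nz by auto
        then show "p r = \<gamma> / \<gamma>0 * p (r - s)" using \<gamma>0_nz unfolding 1(1)[symmetric]
          by (simp add: field_simps 1(2)[symmetric])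
      qed
    qed
    moreover have "cmod (\<gamma> / \<gamma>0) = 1" using \<gamma>(1) \<gamma>0(1) \<gamma>0_nz by (simp add: norm_divide coeff_nonzero m_mem M_mem)
    ultimately show "\<exists>g. cmod g = 1 \<and> (AE t in lborel. t \<in> {s..T} \<longrightarrow> p t = g * p (t - s))" by blast
  qed
  then obtain \<alpha> \<beta> where p: "AE r in lborel. r \<in> {0..T} \<longrightarrow> p r = \<alpha> * cis (\<beta> * r)" by blast
  have "AE r in lborel. r \<in> {0..T} \<longrightarrow> \<alpha> * cis (\<beta> * r) * cnj (q r) = \<gamma>0"
    using p \<gamma>0(2) by eventually_elim auto
  from AE_on_interval_witness[OF this T_pos] have \<alpha>: "\<alpha> \<noteq> 0" using \<gamma>0_nz by auto
  \<comment> \<open>Since \<open>q\<close> enters conjugated, it inherits the frequency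
    \<open>\<beta>\<close> of \<open>p\<close>; this is why one modulation flattens both extreme
    blocks.\<close>
  have q: "AE r in lborel. r \<in> {0..T} \<longrightarrow> q r = cnj (\<gamma>0 / \<alpha>) * cis (\<beta> * r)"
    using p \<gamma>0(2)
  proof eventually_elim
    case (elim r)
    show ?case
    proof
      assume "r \<in> {0..T}"
      then have "\<alpha> * cis (\<beta> * r) * cnj (q r) = \<gamma>0" using elim by metis
      then have "\<gamma>0 / \<alpha> = cis (\<beta> * r) * cnj (q r)"
        using \<alpha> by (simp add: divide_eq_eq mult.commute mult.left_commute)
      then have "\<gamma>0 / \<alpha> * cis (- (\<beta> * r)) = (cis (\<beta> * r) * cis (- (\<beta> * r))) * cnj (q r)"
        by (simp only: mult_ac)
      then have "cnj (q r) = \<gamma>0 / \<alpha> * cis (- (\<beta> * r))"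
        by (simp add: cis_mult)
      then have "cnj (cnj (q r)) = cnj (\<gamma>0 / \<alpha> * cis (- (\<beta> * r)))" by (rule arg_cong)
      then show "q r = cnj (\<gamma>0 / \<alpha>) * cis (\<beta> * r)" by (simp add: cis_cnj)
    qed
  qed
  have move: "AE t in lborel. t \<in> block T k \<longrightarrow> v t = a * cis (- (\<beta> * of_int k)) * cis (\<beta> * t)"
    if "AE r in lborel. r \<in> {0..T} \<longrightarrow> v (of_int k + r) = a * cis (\<beta> * r)" for k a
  proof -
    have "AE t in lborel. - of_int k + 1 * t \<in> {0..T} \<longrightarrow>
       v (of_int k + (- of_int k + 1 * t)) = a * cis (\<beta> * (- of_int k + 1 * t))"
      by (rule AE_lborel_affine[OF that]) simp
    then show ?thesis
    proof eventually_elim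
      case (elim t)
      then show ?case by (auto simp: mult.assoc cis_mult algebra_simps)
    qed
  qed
  have "cmod ((cnj (\<gamma>0 / \<alpha>) * cis (- (\<beta> * of_int m))) * (\<alpha> * cis (- (\<beta> * of_int M)))) = cmod (c m * c M)"
    using \<alpha> \<gamma>0(1) by (simp add: norm_mult norm_divide)
  then show ?thesis using move[OF q[unfolded q_def]] move[OF p[unfolded p_def]] by blast
qed

text \<open>Only the product of the moduli on the extreme blocks is recorded: the individual moduli
  are not yet determined, and a reflection interchanges them.\<close>

definition normalized :: "(real \<Rightarrow> complex) \<Rightarrow> complex \<Rightarrow> complex \<Rightarrow> bool" where
  "normalized v \<alpha> \<alpha>' \<longleftrightarrow> partner v \<and> (AE t in lborel. t \<notin> {of_int m..of_int M + T} \<longrightarrow> v t = 0) \<and>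
     cmod (\<alpha> * \<alpha>') = cmod (c m * c M) \<and>
     (AE t in lborel. t \<in> block T m \<longrightarrow> v t = \<alpha>) \<and> (AE t in lborel. t \<in> block T M \<longrightarrow> v t = \<alpha>')"

lemma partner_normalized:
  assumes "partner v"
  shows "\<exists>v' \<alpha> \<alpha>'. trivial_transform v v' \<and> normalized v' \<alpha> \<alpha>'"
proof -
  obtain v1 where v1: "trivial_transform v v1" "partner v1"
    "AE t in lborel. t \<notin> {of_int m..of_int M + T} \<longrightarrow> v1 t = 0"
    using partner_supported[OF assms] by blast
  obtain \<beta> \<alpha> \<alpha>' where \<alpha>: "cmod (\<alpha> * \<alpha>') = cmod (c m * c M)"
    "AE t in lborel. t \<in> block T m \<longrightarrow> v1 t = \<alpha> * cis (\<beta> * t)"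
    "AE t in lborel. t \<in> block T M \<longrightarrow> v1 t = \<alpha>' * cis (\<beta> * t)"
    using extreme_blocks_exponential[OF v1(2,3)] by blast
  define v2 where "v2 = (\<lambda>t. cis (0 + - \<beta> * t) * v1 (1 * t - 0))"
  have v2: "v2 t = cis (- (\<beta> * t)) * v1 t" for t by (simp add: v2_def)
  have canc: "cis (- (\<beta> * t)) * (a * cis (\<beta> * t)) = a" for t a by (simp add: cis_mult mult.left_commute)
  have "trivial_transform v1 v2" "partner v2"
    using partner_transform[OF v1(2), of 1 0 "- \<beta>" 0] unfolding v2_def by auto
  moreover have "AE t in lborel. t \<notin> {of_int m..of_int M + T} \<longrightarrow> v2 t = 0"
    using v1(3) by eventually_elim (auto simp: v2)
  moreover have "AE t in lborel. t \<in> block T m \<longrightarrow> v2 t = \<alpha>"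
    using \<alpha>(2) by eventually_elim (simp add: v2 canc)
  moreover have "AE t in lborel. t \<in> block T M \<longrightarrow> v2 t = \<alpha>'"
    using \<alpha>(3) by eventually_elim (simp add: v2 canc)
  ultimately show ?thesis
    using \<alpha>(1) trivial_transform_trans[OF v1(1)] unfolding normalized_def by blast
qed

lemma normalizedD:
  assumes "normalized v \<alpha> \<alpha>'"
  shows "partner v" "AE t in lborel. t \<notin> {of_int m..of_int M + T} \<longrightarrow> v t = 0"
    "cmod (\<alpha> * \<alpha>') = cmod (c m * c M)"
    "AE t in lborel. t \<in> block T m \<longrightarrow> v t = \<alpha>" "AE t in lborel. t \<in> block T M \<longrightarrow> v t = \<alpha>'"
    "\<alpha> \<noteq> 0" "\<alpha>' \<noteq> 0"
proof -
  show prod: "cmod (\<alpha> * \<alpha>') = cmod (c m * c M)" using assms by (simp add: normalized_def)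
  have "c m * c M \<noteq> 0" using coeff_nonzero m_mem M_mem by simp
  then have "\<alpha> * \<alpha>' \<noteq> 0" using prod by (metis norm_eq_zero)
  then show "\<alpha> \<noteq> 0" "\<alpha>' \<noteq> 0" by auto
qed (use assms in \<open>auto simp: normalized_def\<close>)

section \<open>Vanishing off the pulses or off their reflections\<close>

text \<open>A window of length \<open>T\<close> is paired with one extreme block, on which
  \<open>v\<close> is a nonzero constant. If the shift that aligns them is far from all differences,
  the product vanishes and the constant can be divided out.\<close>

lemma window_zero:
  assumes v: "normalized v \<alpha> \<alpha>'"
    and far: "(\<forall>j\<in>\<Lambda>. \<forall>k\<in>\<Lambda>. T \<le> \<bar>\<tau> - of_int m - of_int (j - k)\<bar>) \<or>
      (\<forall>j\<in>\<Lambda>. \<forall>k\<in>\<Lambda>. T \<le> \<bar>of_int M - \<tau> - of_int (j - k)\<bar>)"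
  shows "AE t in lborel. t \<in> {\<tau>..\<tau> + T} \<longrightarrow> v t = 0"
  using far
proof
  assume "\<forall>j\<in>\<Lambda>. \<forall>k\<in>\<Lambda>. T \<le> \<bar>\<tau> - of_int m - of_int (j - k)\<bar>"
  then have 1: "AE t in lborel. v t * cnj (v (t - (\<tau> - of_int m))) = 0"
    by (intro product_zero_if_no_difference_near[OF normalizedD(1)[OF v]]) auto
  have "AE t in lborel. (of_int m - \<tau>) + 1 * t \<in> block T m \<longrightarrow> v ((of_int m - \<tau>) + 1 * t) = \<alpha>"
    by (rule AE_lborel_affine[OF normalizedD(4)[OF v]]) simp
  with 1 show ?thesis
  proof eventually_elim
    case (elim t)
    have eq: "t - (\<tau> - of_int m) = (of_int m - \<tau>) + 1 * t" by simp
    have "(of_int m - \<tau>) + 1 * t \<in> block T m" if "t \<in> {\<tau>..\<tau> + T}" using that by auto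
    then show ?case using elim(2) normalizedD(6)[OF v] elim(1)[unfolded eq]
      by (metis complex_cnj_zero_iff mult_eq_0_iff)
  qed
next
  assume "\<forall>j\<in>\<Lambda>. \<forall>k\<in>\<Lambda>. T \<le> \<bar>of_int M - \<tau> - of_int (j - k)\<bar>"
  then have "AE t in lborel. v t * cnj (v (t - (of_int M - \<tau>))) = 0"
    by (intro product_zero_if_no_difference_near[OF normalizedD(1)[OF v]]) auto
  from AE_lborel_affine[OF this, of 1 "of_int M - \<tau>"]
  have 1: "AE t in lborel. v (of_int M - \<tau> + 1 * t) * cnj (v t) = 0" by simp
  have "AE t in lborel. (of_int M - \<tau>) + 1 * t \<in> block T M \<longrightarrow> v ((of_int M - \<tau>) + 1 * t) = \<alpha>'"
    by (rule AE_lborel_affine[OF normalizedD(5)[OF v]]) simp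
  with 1 show ?thesis
  proof eventually_elim
    case (elim t)
    have "(of_int M - \<tau>) + 1 * t \<in> block T M" if "t \<in> {\<tau>..\<tau> + T}" using that by auto
    then show ?case using elim normalizedD(7)[OF v]
      by (metis complex_cnj_zero_iff mult_eq_0_iff)
  qed
qed

text \<open>A window starting between \<open>k + T\<close> and \<open>k + 1 - T\<close> needs a
  shift at distance at least \<open>T\<close> from every integer, so \<open>window_zero\<close>
  applies. Countably many such windows cover the gap.\<close>

lemma gap_zero:
  assumes v: "normalized v \<alpha> \<alpha>'"
  shows "AE t in lborel. t \<in> {of_int k + T..of_int k + 1} \<longrightarrow> v t = 0"
proof -
  have win: "AE t in lborel. t \<in> {\<tau>..\<tau> + T} \<longrightarrow> v t = 0" if \<tau>: "of_int k + T \<le> \<tau>" "\<tau> \<le> of_int k + 1 - T" for \<tau>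
  proof (rule window_zero[OF v], intro disjI1 ballI)
    fix i j :: int
    define d where "d = k - m - (i - j)"
    have "\<tau> - of_int m - of_int (i - j) = \<tau> - of_int k + of_int d" by (simp add: d_def)
    moreover have "d \<ge> 0 \<or> d \<le> -1" by linarith
    then have "(0::real) \<le> of_int d \<or> of_int d \<le> (-1::real)" by linarith
    ultimately show "T \<le> \<bar>\<tau> - of_int m - of_int (i - j)\<bar>" using \<tau> by linarith
  qed
  \<comment> \<open>Steps of length \<open>T\<close>, truncated so that the last window ends at
    \<open>k + 1\<close>.\<close>
  define \<tau> where "\<tau> n = min (of_int k + T + real n * T) (of_int k + 1 - T)" for n
  have "AE t in lborel. \<forall>n. t \<in> {\<tau> n..\<tau> n + T} \<longrightarrow> v t = 0"
    unfolding AE_all_countable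
  proof
    fix n
    have "0 \<le> real n * T" using T_pos by simp
    then show "AE t in lborel. t \<in> {\<tau> n..\<tau> n + T} \<longrightarrow> v t = 0"
      by (intro win) (use T_le in \<open>auto simp: \<tau>_def\<close>)
  qed
  then show ?thesis
  proof eventually_elim
    case (elim t)
    show ?case
    proof
      assume t: "t \<in> {of_int k + T..of_int k + 1}"
      define n where "n = nat \<lfloor>(t - of_int k - T) / T\<rfloor>"
      have nn: "0 \<le> (t - of_int k - T) / T" using t T_pos by auto
      then have "real n = of_int \<lfloor>(t - of_int k - T) / T\<rfloor>" by (simp add: n_def)
      then have "real n \<le> (t - of_int k - T) / T" "(t - of_int k - T) / T < real n + 1" by linarith+
      then have "real n * T \<le> t - of_int k - T" "t - of_int k - T < real n * T + T"
        using T_pos by (auto simp: field_simps)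
      then have "t \<in> {\<tau> n..\<tau> n + T}" using t unfolding \<tau>_def by auto
      then show "v t = 0" using elim by blast
    qed
  qed
qed

text \<open>If \<open>v\<close> does not vanish on block \<open>k\<close>, then pairing that block with the two extreme blocks makes both
  \<open>k - m\<close> and \<open>M - k\<close> differences of elements of \<open>\<Lambda>\<close>; adding the two representations gives two sums
  of three elements to compare.\<close>

lemma block_zero:
  assumes v: "normalized v \<alpha> \<alpha>'" and k: "k \<notin> \<Lambda>" "m + M - k \<notin> \<Lambda>"
  shows "AE t in lborel. t \<in> block T k \<longrightarrow> v t = 0"
proof (rule window_zero[OF v], rule ccontr)
  have near: "a = b" if "\<not> T \<le> \<bar>of_int a - of_int b\<bar>" for a b :: int
  proof -
    have "\<bar>of_int a - of_int b\<bar> < (1::real)" using that T_le by linarith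
    then show ?thesis by linarith
  qed
  assume "\<not> ((\<forall>i\<in>\<Lambda>. \<forall>j\<in>\<Lambda>. T \<le> \<bar>of_int k - of_int m - of_int (i - j)\<bar>) \<or>
      (\<forall>i\<in>\<Lambda>. \<forall>j\<in>\<Lambda>. T \<le> \<bar>of_int M - of_int k - of_int (i - j)\<bar>))"
  then obtain i j i' j' where ij: "i \<in> \<Lambda>" "j \<in> \<Lambda>" "i' \<in> \<Lambda>" "j' \<in> \<Lambda>"
    and "\<not> T \<le> \<bar>of_int (k - m) - of_int (i - j)\<bar>" "\<not> T \<le> \<bar>of_int (M - k) - of_int (i' - j')\<bar>"
    by (auto simp del: of_int_diff simp: of_int_diff[symmetric])
  then have d: "k - m = i - j" "M - k = i' - j'" using near by blast+
  have "{#M, j, j'#} = {#m, i, i'#}"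
    by (rule B3_setD[OF B3]) (use d ij m_mem M_mem in auto)
  \<comment> \<open>Whichever summand \<open>M\<close> is matched with, either \<open>k\<close> or
    \<open>m + M - k\<close> turns out to lie in \<open>\<Lambda>\<close>.\<close>
  from mset3_eqD[OF this]
  consider "M = m" | "M = i" "{#j, j'#} = {#m, i'#}" | "M = i'" "{#j, j'#} = {#m, i#}"
    by blast
  then show False
  proof cases
    case 1
    then have "x = m" if "x \<in> \<Lambda>" for x using m_le[OF that] M_ge[OF that] by simp
    then have "i = m" "j = m" using ij by auto
    then show False using d k m_mem by simp
  next
    case 2
    from mset2_eqD[OF 2(2)] have "j = m \<or> j = i'" by blast
    then have "k = M \<or> m + M - k = i'" using d(1) 2(1) by auto
    then show False using k ij M_mem by auto
  next
    case 3
    from mset2_eqD[OF 3(2)] have "j = m \<or> j = i" by blast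
    then show False using d k ij m_mem by auto
  qed
qed

text \<open>With \<open>l = m + M - k'\<close>, a representation \<open>k - k' = i - j\<close> would
  read \<open>k + l + j = m + M + i\<close>, which \<open>B\<^sub>3\<close> excludes. So every shift
  that brings the two blocks together gives a zero product, and one of the two restrictions of
  \<open>v\<close> vanishes.\<close>

lemma direct_or_reflected_block_zero:
  assumes v: "normalized v \<alpha> \<alpha>'"
    and k: "k \<in> \<Lambda>" "m + M - k \<notin> \<Lambda>" and k': "k' \<notin> \<Lambda>" "m + M - k' \<in> \<Lambda>"
  shows "(AE t in lborel. t \<in> block T k \<longrightarrow> v t = 0) \<or> (AE t in lborel. t \<in> block T k' \<longrightarrow> v t = 0)"
proof -
  note [measurable] = partnerD(2)[OF normalizedD(1)[OF v]]
  have not_diff: "k - k' \<noteq> i - j" if ij: "i \<in> \<Lambda>" "j \<in> \<Lambda>" for i j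
  proof
    define l where "l = m + M - k'"
    assume "k - k' = i - j"
    then have "{#k, l, j#} = {#m, M, i#}"
      using k k' ij m_mem M_mem by (intro B3_setD[OF B3]) (auto simp: l_def)
    from mset3_eqD[OF this] have "k = m \<or> k = M \<or> {#l, j#} = {#m, M#}" by blast
    \<comment> \<open>The reflection exchanges \<open>m\<close> and \<open>M\<close>, so neither has
      its mirror image outside \<open>\<Lambda>\<close>.\<close>
    moreover have "k \<noteq> m" "k \<noteq> M" using k m_mem M_mem by auto
    ultimately have "{#l, j#} = {#m, M#}" by blast
    from mset2_eqD[OF this] have "l = m \<or> l = M" by blast
    then show False using k' m_mem M_mem by (auto simp: l_def)
  qed
  have "(AE t in lborel. v t * indicator (block T k) t = 0) \<or> (AE t in lborel. cnj (v t) * indicator (block T k') t = 0)"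
  proof (rule AE_zero_if_all_shifted_products_zero)
    fix x
    show "AE t in lborel. (v t * indicator (block T k) t) * (cnj (v (t - x)) * indicator (block T k') (t - x)) = 0"
    proof (cases "\<forall>i\<in>\<Lambda>. \<forall>j\<in>\<Lambda>. T \<le> \<bar>x - of_int (i - j)\<bar>")
      case True
      then have "AE t in lborel. v t * cnj (v (t - x)) = 0"
        by (intro product_zero_if_no_difference_near[OF normalizedD(1)[OF v]]) auto
      then show ?thesis by eventually_elim auto
    next
      case False
      then obtain i j where ij: "i \<in> \<Lambda>" "j \<in> \<Lambda>" "\<bar>x - of_int (i - j)\<bar> < T" by force
      have "t \<notin> block T k \<or> t - x \<notin> block T k'" for t
      proof (rule ccontr)
        assume "\<not> ?thesis"
        then have "\<bar>x - of_int (k - k')\<bar> \<le> T" by (auto simp: abs_le_iff)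
        then have "\<bar>of_int (k - k') - of_int (i - j)\<bar> < (1::real)" using ij(3) T_le by linarith
        then have "k - k' = i - j" by linarith
        then show False using not_diff ij by blast
      qed
      then show ?thesis by (intro AE_I2) (auto simp: indicator_def)
    qed
  qed auto
  moreover have "AE t in lborel. t \<in> A \<longrightarrow> v t = 0"
    if "(AE t in lborel. v t * indicator A t = 0) \<or> (AE t in lborel. cnj (v t) * indicator A t = 0)" for A
    using that by (auto elim!: eventually_mono simp: indicator_def split: if_splits)
  ultimately show ?thesis by blast
qed

text \<open>The alternative for pairs of blocks becomes global: one nonvanishing block that is only
  in \<open>\<Lambda>\<close> annihilates all blocks that are only in the reflection. Blocks in both
  sets are allowed in either case.\<close>

lemma normalized_support:
  assumes v: "normalized v \<alpha> \<alpha>'"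
  shows "(AE t in lborel. (\<forall>k\<in>\<Lambda>. t \<notin> block T k) \<longrightarrow> v t = 0) \<or>
    (AE t in lborel. (\<forall>k. m + M - k \<in> \<Lambda> \<longrightarrow> t \<notin> block T k) \<longrightarrow> v t = 0)"
proof -
  have "AE t in lborel. \<forall>k. t \<in> {of_int k + T..of_int k + 1} \<longrightarrow> v t = 0"
    unfolding AE_all_countable using gap_zero[OF v] by blast
  moreover have "AE t in lborel. \<forall>k. k \<notin> \<Lambda> \<and> m + M - k \<notin> \<Lambda> \<longrightarrow> t \<in> block T k \<longrightarrow> v t = 0"
    unfolding AE_all_countable using block_zero[OF v] by auto
  ultimately have base: "AE t in lborel. v t = 0 \<or> t \<in> block T \<lfloor>t\<rfloor> \<and> (\<lfloor>t\<rfloor> \<in> \<Lambda> \<or> m + M - \<lfloor>t\<rfloor> \<in> \<Lambda>)"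
  proof eventually_elim
    case (elim t)
    show ?case
    proof (cases "t \<le> of_int \<lfloor>t\<rfloor> + T")
      case True
      then have "t \<in> block T \<lfloor>t\<rfloor>" by simp
      then show ?thesis using elim(2) by blast
    next
      case False
      then have "t \<in> {of_int \<lfloor>t\<rfloor> + T..of_int \<lfloor>t\<rfloor> + 1}" by simp
      then show ?thesis using elim(1) by blast
    qed
  qed
  show ?thesis
  proof (cases "\<forall>k. k \<in> \<Lambda> \<and> m + M - k \<notin> \<Lambda> \<longrightarrow> (AE t in lborel. t \<in> block T k \<longrightarrow> v t = 0)")
    case True
    then have "AE t in lborel. \<forall>k. k \<in> \<Lambda> \<and> m + M - k \<notin> \<Lambda> \<longrightarrow> t \<in> block T k \<longrightarrow> v t = 0"
      unfolding AE_all_countable by auto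
    with base have "AE t in lborel. (\<forall>k. m + M - k \<in> \<Lambda> \<longrightarrow> t \<notin> block T k) \<longrightarrow> v t = 0"
      by eventually_elim blast
    then show ?thesis ..
  next
    case False
    then have "\<forall>k. k \<notin> \<Lambda> \<and> m + M - k \<in> \<Lambda> \<longrightarrow> (AE t in lborel. t \<in> block T k \<longrightarrow> v t = 0)"
      using direct_or_reflected_block_zero[OF v] by blast
    then have "AE t in lborel. \<forall>k. k \<notin> \<Lambda> \<and> m + M - k \<in> \<Lambda> \<longrightarrow> t \<in> block T k \<longrightarrow> v t = 0"
      unfolding AE_all_countable by auto
    with base have "AE t in lborel. (\<forall>k\<in>\<Lambda>. t \<notin> block T k) \<longrightarrow> v t = 0"
      by eventually_elim blast
    then show ?thesis ..
  qed
qed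

text \<open>The centre is chosen so that \<open>s - t\<close> maps block \<open>k\<close> onto block
  \<open>m + M - k\<close>; in particular the extreme blocks and their constants change
  places.\<close>

lemma normalized_reflect:
  assumes v: "normalized v \<alpha> \<alpha>'"
  defines "s \<equiv> of_int m + of_int M + T"
  shows "normalized (\<lambda>t. v (s - t)) \<alpha>' \<alpha>" "trivial_transform v (\<lambda>t. v (s - t))"
proof -
  have refl: "AE t in lborel. P (s - t)" if "AE t in lborel. P t" for P
    using AE_lborel_affine[OF that, of "-1" s] by simp
  have "(\<lambda>t. cis (0 + 0 * t) * v (-1 * t - - s)) = (\<lambda>t. v (s - t))" by simp
  then have "partner (\<lambda>t. v (s - t))" and tt: "trivial_transform v (\<lambda>t. v (s - t))"
    using partner_transform[OF normalizedD(1)[OF v], of "-1" 0 0 "- s"] by simp_all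
  moreover have "AE t in lborel. t \<notin> {of_int m..of_int M + T} \<longrightarrow> v (s - t) = 0"
    using refl[OF normalizedD(2)[OF v]] by eventually_elim (auto simp: s_def)
  moreover have "AE t in lborel. t \<in> block T M \<longrightarrow> v (s - t) = \<alpha>"
    using refl[OF normalizedD(4)[OF v]] by eventually_elim (auto simp: s_def)
  moreover have "AE t in lborel. t \<in> block T m \<longrightarrow> v (s - t) = \<alpha>'"
    using refl[OF normalizedD(5)[OF v]] by eventually_elim (auto simp: s_def)
  ultimately show "normalized (\<lambda>t. v (s - t)) \<alpha>' \<alpha>"
    using normalizedD(3)[OF v] by (simp add: normalized_def mult.commute)
  show "trivial_transform v (\<lambda>t. v (s - t))" by (rule tt)
qed

lemma normalized_on_blocks:
  assumes v: "normalized v \<alpha> \<alpha>'"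
  shows "\<exists>v' \<beta> \<beta>'. trivial_transform v v' \<and> normalized v' \<beta> \<beta>' \<and>
    (AE t in lborel. (\<forall>k\<in>\<Lambda>. t \<notin> block T k) \<longrightarrow> v' t = 0)"
  using normalized_support[OF v]
proof
  assume "AE t in lborel. (\<forall>k\<in>\<Lambda>. t \<notin> block T k) \<longrightarrow> v t = 0"
  then show ?thesis using v trivial_transform_AE_eq[of v v] by auto
next
  define s where "s = of_int m + of_int M + T"
  assume "AE t in lborel. (\<forall>k. m + M - k \<in> \<Lambda> \<longrightarrow> t \<notin> block T k) \<longrightarrow> v t = 0"
  then have "AE t in lborel. (\<forall>k. m + M - k \<in> \<Lambda> \<longrightarrow> s + -1 * t \<notin> block T k) \<longrightarrow> v (s + -1 * t) = 0"
    by (rule AE_lborel_affine) simp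
  then have "AE t in lborel. (\<forall>k\<in>\<Lambda>. t \<notin> block T k) \<longrightarrow> v (s - t) = 0"
  proof eventually_elim
    case (elim t)
    show ?case
    proof
      assume *: "\<forall>k\<in>\<Lambda>. t \<notin> block T k"
      have "s + -1 * t \<notin> block T k" if "m + M - k \<in> \<Lambda>" for k
        using *[rule_format, OF that] by (auto simp: s_def)
      then show "v (s - t) = 0" using elim by simp
    qed
  qed
  then show ?thesis using normalized_reflect[OF v] unfolding s_def by blast
qed

section \<open>Constants on the pulses and their moduli\<close>

text \<open>Offsets within blocks differ by at most \<open>T < 1\<close>, so under an integer shift
  the index differences agree exactly, and uniqueness of nonzero differences identifies the
  pair.\<close>

lemma overlapping_blocks:
  assumes "j \<in> \<Lambda>" "k \<in> \<Lambda>" "j \<noteq> k" "i \<in> \<Lambda>" "l \<in> \<Lambda>"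
    and t: "t \<in> block T i" "t - of_int (j - k) \<in> block T l"
  shows "i = j \<and> l = k"
proof -
  have "\<bar>of_int (j - k) - of_int (i - l)\<bar> < (1::real)"
    using t T_less_1 by (auto simp: abs_less_iff)
  then have "j - k = i - l" by linarith
  then show ?thesis using difference_unique[of j k i l] assms by auto
qed

lemma pulse_product:
  assumes "j \<in> \<Lambda>" "k \<in> \<Lambda>" "j \<noteq> k"
  shows "pulse_signal \<Lambda> T a t * cnj (pulse_signal \<Lambda> T a (t - of_int (j - k)))
    = a j * cnj (a k) * indicator (block T j) t"
proof (cases "t \<in> block T j")
  case True
  then have k: "t - of_int (j - k) \<in> block T k" by auto
  show ?thesis
    unfolding pulse_signal_on_block[OF T_less_1 True] pulse_signal_on_block[OF T_less_1 k]
    using True assms by simp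
next
  case False
  have "pulse_signal \<Lambda> T a t = 0 \<or> pulse_signal \<Lambda> T a (t - of_int (j - k)) = 0"
  proof (rule ccontr)
    assume "\<not> ?thesis"
    then obtain i l where "i \<in> \<Lambda>" "t \<in> block T i" "l \<in> \<Lambda>" "t - of_int (j - k) \<in> block T l"
      by (metis pulse_signal_nonzeroE[OF T_less_1])
    then show False using overlapping_blocks[OF assms] False by blast
  qed
  then show ?thesis using False by auto
qed

lemma normalized_pulse:
  assumes v: "normalized v \<alpha> \<alpha>'"
    and supp: "AE t in lborel. (\<forall>k\<in>\<Lambda>. t \<notin> block T k) \<longrightarrow> v t = 0"
  shows "\<exists>a. AE t in lborel. v t = pulse_signal \<Lambda> T a t"
proof -
  have "\<exists>a. AE t in lborel. t \<in> block T k \<longrightarrow> v t = a" if k: "k \<in> \<Lambda>" for k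
  proof (cases "k = m")
    \<comment> \<open>For \<open>k = m\<close> the shift would be 0 and would pair every block with
      itself, so constancy has to come from the normalization.\<close>
    case True then show ?thesis using normalizedD(4)[OF v] by blast
  next
    case False
    define x where "x = real_of_int (k - m)"
    have pair: "i = k \<and> j = m" if "i \<in> \<Lambda>" "j \<in> \<Lambda>" "t \<in> block T i" "t - x \<in> block T j" for i j t
      using overlapping_blocks[OF k m_mem False that(1,2,3)] that(4) by (simp add: x_def)
    have "\<exists>\<gamma>. cmod \<gamma> = cmod (c k * cnj (c m)) \<and>
      (AE t in lborel. t \<in> block T k \<longrightarrow> v t * cnj (v (t - x)) = \<gamma>)"
    proof (rule AE_product_const_if_ambiguity[OF u_measurable partnerD(1) _ _ partnerD(3)])
      show "partner v" "partner v" by (rule normalizedD(1)[OF v])+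
      have "AE t in lborel. (\<forall>k\<in>\<Lambda>. - x + 1 * t \<notin> block T k) \<longrightarrow> v (- x + 1 * t) = 0"
        by (rule AE_lborel_affine[OF supp]) simp
      with supp show "AE t in lborel. t \<notin> block T k \<longrightarrow> v t * cnj (v (t - x)) = 0"
      proof eventually_elim
        case (elim t)
        have "- x + 1 * t = t - x" by simp
        then show ?case using elim pair[of _ _ t] by (metis complex_cnj_zero mult_zero_left mult_zero_right)
      qed
      show "AE t in lborel. u t * cnj (u (t - x)) = c k * cnj (c m) * indicator (block T k) t"
        unfolding u_def x_def pulse_product[OF k m_mem False] by simp
    qed (use T_pos in auto)
    then obtain \<gamma> where "AE t in lborel. t \<in> block T k \<longrightarrow> v t * cnj (v (t - x)) = \<gamma>" by blast
    moreover have "AE t in lborel. - x + 1 * t \<in> block T m \<longrightarrow> v (- x + 1 * t) = \<alpha>"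
      by (rule AE_lborel_affine[OF normalizedD(4)[OF v]]) simp
    ultimately have "AE t in lborel. t \<in> block T k \<longrightarrow> v t = \<gamma> / cnj \<alpha>"
    proof eventually_elim
      case (elim t)
      have "- x + 1 * t = t - x" by simp
      moreover have "t - x \<in> block T m" if "t \<in> block T k" using that by (auto simp: x_def)
      ultimately show ?case using elim normalizedD(6)[OF v] by (auto simp: field_simps)
    qed
    then show ?thesis by blast
  qed
  then obtain a where a: "\<And>k. k \<in> \<Lambda> \<Longrightarrow> AE t in lborel. t \<in> block T k \<longrightarrow> v t = a k" by metis
  have "AE t in lborel. \<forall>k\<in>\<Lambda>. t \<in> block T k \<longrightarrow> v t = a k"
    using a finite_pos by (intro AE_finite_allI) auto
  with supp have "AE t in lborel. v t = pulse_signal \<Lambda> T a t"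
  proof eventually_elim
    case (elim t)
    show ?case
    proof (cases "\<exists>k\<in>\<Lambda>. t \<in> block T k")
      case True
      then show ?thesis using elim by (auto simp: pulse_signal_on_block[OF T_less_1])
    next
      case False
      then have "pulse_signal \<Lambda> T a t = 0" by (metis pulse_signal_nonzeroE[OF T_less_1])
      then show ?thesis using elim False by simp
    qed
  qed
  then show ?thesis by blast
qed

lemma cmod_ambiguity_pulse_difference:
  assumes "j \<in> \<Lambda>" "k \<in> \<Lambda>" "j \<noteq> k"
  shows "cmod (ambiguity (pulse_signal \<Lambda> T a) (of_int (j - k)) 0) = T * (cmod (a j) * cmod (a k))"
proof -
  have key: "a j * cnj (a k) * indicator (block T j) t = (a j * cnj (a k)) * of_real (indicat_real (block T j) t)" for t
    by (simp add: indicator_def)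
  have "ambiguity (pulse_signal \<Lambda> T a) (of_int (j - k)) 0
      = (LINT t|lborel. (a j * cnj (a k)) * of_real (indicat_real (block T j) t))"
    unfolding ambiguity_def pulse_product[OF assms] key by (simp only: mult_zero_left cis_zero mult_1_right)
  also have "\<dots> = (a j * cnj (a k)) * of_real T"
    using T_pos by (simp only: integral_mult_right_zero integral_of_real) simp
  finally show ?thesis using T_pos by (simp add: norm_mult)
qed

lemma ambiguity_pulse_0:
  "ambiguity (pulse_signal \<Lambda> T a) 0 0 = of_real (T * (\<Sum>j\<in>\<Lambda>. (cmod (a j))\<^sup>2))"
proof -
  have "pulse_signal \<Lambda> T a t * cnj (pulse_signal \<Lambda> T a t)
      = (\<Sum>j\<in>\<Lambda>. of_real ((cmod (a j))\<^sup>2 * indicat_real (block T j) t))" for t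
  proof -
    have "pulse_signal \<Lambda> T a t * cnj (pulse_signal \<Lambda> T a t) = pulse_signal \<Lambda> T (\<lambda>j. a j * cnj (a j)) t"
      by (simp add: pulse_signal_eq[OF T_less_1])
    also have "\<dots> = (\<Sum>j\<in>\<Lambda>. a j * cnj (a j) * indicator (block T j) t)"
      using finite_pos by (simp add: pulse_signal_def)
    also have "\<dots> = (\<Sum>j\<in>\<Lambda>. of_real ((cmod (a j))\<^sup>2 * indicat_real (block T j) t))"
      by (intro sum.cong refl) (simp add: indicator_def complex_norm_square del: of_real_power)
    finally show ?thesis .
  qed
  then have "ambiguity (pulse_signal \<Lambda> T a) 0 0
      = (LINT t|lborel. (\<Sum>j\<in>\<Lambda>. of_real ((cmod (a j))\<^sup>2 * indicat_real (block T j) t)))"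
    by (simp add: ambiguity_def)
  also have "\<dots> = of_real (\<Sum>j\<in>\<Lambda>. LINT t|lborel. (cmod (a j))\<^sup>2 * indicat_real (block T j) t)"
    unfolding of_real_sum[symmetric] integral_complex_of_real
    by (subst Bochner_Integration.integral_sum)
       (use T_pos in \<open>auto intro!: integrable_mult_right integrable_real_indicator\<close>)
  also have "\<dots> = of_real (T * (\<Sum>j\<in>\<Lambda>. (cmod (a j))\<^sup>2))"
    using T_pos by (simp add: sum_distrib_left mult.commute)
  finally show ?thesis .
qed

lemma phases_if_moduli_eq:
  assumes "\<And>j. j \<in> \<Lambda> \<Longrightarrow> cmod (a j) = cmod (c j)"
  shows "\<exists>\<omega>::int \<Rightarrow> real. \<forall>t. pulse_signal \<Lambda> T a t = pulse_signal \<Lambda> T (\<lambda>j. cis (\<omega> j) * c j) t"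
proof -
  have "cis (Arg (a j / c j)) * c j = a j" if "j \<in> \<Lambda>" for j
  proof -
    have "cmod (a j / c j) = 1" using assms[OF that] coeff_nonzero[OF that] by (simp add: norm_divide)
    then have "cis (Arg (a j / c j)) = a j / c j"
      by (metis cis_Arg norm_zero zero_neq_one sgn_eq div_by_1 of_real_1)
    then show ?thesis using coeff_nonzero[OF that] by simp
  qed
  then show ?thesis
    by (intro exI[of _ "\<lambda>j. Arg (a j / c j)"]) (simp add: pulse_signal_eq[OF T_less_1])
qed

text \<open>A two-point set is symmetric about its centre, so reflecting the signal merely swaps its
  two coefficients.\<close>

lemma pulse_signal_reflect_pair:
  "pulse_signal {j, k} T a (of_int j + of_int k + T - t)
    = pulse_signal {j, k} T (\<lambda>i. a (j + k - i)) t"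
proof -
  have block: "pulse_signal {j, k} T a (of_int j + of_int k + T - t)
      = pulse_signal {j, k} T (\<lambda>i. a (j + k - i)) t" if "t \<in> block T i" "i \<in> {j, k}" for i
  proof -
    have t': "of_int j + of_int k + T - t \<in> block T (j + k - i)" using that by auto
    show ?thesis
      unfolding pulse_signal_on_block[OF T_less_1 that(1)] pulse_signal_on_block[OF T_less_1 t']
      using that(2) by auto
  qed
  show ?thesis
  proof (cases "t \<in> block T j \<or> t \<in> block T k")
    case True then show ?thesis using block by blast
  next
    case False
    then have "pulse_signal {j, k} T (\<lambda>i. a (j + k - i)) t = 0"
      using pulse_signal_nonzeroE[OF T_less_1, of "{j, k}"] by blast
    moreover have "pulse_signal {j, k} T a (of_int j + of_int k + T - t) = 0"
    proof (rule ccontr)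
      assume "\<not> ?thesis"
      then obtain i where "i \<in> {j, k}" "of_int j + of_int k + T - t \<in> block T i"
        using pulse_signal_nonzeroE[OF T_less_1] by blast
      then show False using False by auto
    qed
    ultimately show ?thesis by simp
  qed
qed

text \<open>The moduli \<open>\<bar>a\<^sub>j\<bar>\<close> are determined by their pairwise products as soon as there are three of them. For two
  pulses, product and energy leave the possibility that the moduli are interchanged, which is undone by
  a reflection.\<close>

lemma pulse_coefficients:
  assumes amb: "\<And>x y. cmod (ambiguity (pulse_signal \<Lambda> T a) x y) = cmod (ambiguity u x y)"
  shows "\<exists>\<omega>::int \<Rightarrow> real. trivial_transform (pulse_signal \<Lambda> T (\<lambda>j. cis (\<omega> j) * c j)) (pulse_signal \<Lambda> T a)"
proof -
  have prod: "cmod (a j) * cmod (a k) = cmod (c j) * cmod (c k)" if "j \<in> \<Lambda>" "k \<in> \<Lambda>" "j \<noteq> k" for j k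
    using amb[of "of_int (j - k)" 0] T_pos
    unfolding u_def cmod_ambiguity_pulse_difference[OF that] by simp
  have "cmod (of_real (T * (\<Sum>j\<in>\<Lambda>. (cmod (a j))\<^sup>2))) = cmod (of_real (T * (\<Sum>j\<in>\<Lambda>. (cmod (c j))\<^sup>2)))"
    using amb[of 0 0] unfolding u_def ambiguity_pulse_0 .
  then have energy: "(\<Sum>j\<in>\<Lambda>. (cmod (a j))\<^sup>2) = (\<Sum>j\<in>\<Lambda>. (cmod (c j))\<^sup>2)"
    unfolding norm_of_real using T_pos by (simp add: abs_mult sum_nonneg)
  have pos: "cmod (c j) > 0" if "j \<in> \<Lambda>" for j using coeff_nonzero[OF that] by simp
  show ?thesis
  proof (cases "\<forall>j\<in>\<Lambda>. cmod (a j) = cmod (c j)")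
    case True
    then obtain \<omega> :: "int \<Rightarrow> real" where "\<forall>t. pulse_signal \<Lambda> T a t = pulse_signal \<Lambda> T (\<lambda>j. cis (\<omega> j) * c j) t"
      using phases_if_moduli_eq by blast
    then show ?thesis by (intro exI[of _ \<omega>] trivial_transform_AE_eq) auto
  next
    case False
    then obtain j where j: "j \<in> \<Lambda>" "cmod (a j) \<noteq> cmod (c j)" by blast
    \<comment> \<open>For a single pulse the energy alone fixes the modulus, so a wrong modulus
      requires a second pulse.\<close>
    have "\<Lambda> \<noteq> {j}" using energy j by auto
    then obtain k where k: "k \<in> \<Lambda>" "k \<noteq> j" using j by blast
    have "i = j \<or> i = k" if i: "i \<in> \<Lambda>" for i
    proof (rule ccontr)
      assume "\<not> ?thesis"
      then have ne: "i \<noteq> j" "i \<noteq> k" by auto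
      \<comment> \<open>With three pulses, the products of \<open>j\<close> with \<open>k\<close>
        and with \<open>i\<close>, divided by the product of \<open>k\<close> with \<open>i\<close>,
        isolate the square at \<open>j\<close>.\<close>
      have "(cmod (a j))\<^sup>2 * (cmod (a k) * cmod (a i)) = (cmod (a j) * cmod (a k)) * (cmod (a j) * cmod (a i))"
        by (simp add: power2_eq_square)
      also have "\<dots> = (cmod (c j) * cmod (c k)) * (cmod (c j) * cmod (c i))"
        using prod i j k ne by simp
      also have "\<dots> = (cmod (c j))\<^sup>2 * (cmod (c k) * cmod (c i))" by (simp add: power2_eq_square)
      finally have "(cmod (a j))\<^sup>2 * (cmod (c k) * cmod (c i)) = (cmod (c j))\<^sup>2 * (cmod (c k) * cmod (c i))"
        using prod i k ne by simp
      then have "(cmod (a j))\<^sup>2 = (cmod (c j))\<^sup>2" using pos[OF i] pos[OF k(1)] by simp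
      then show False using j by simp
    qed
    then have \<Lambda>: "\<Lambda> = {j, k}" using j k by auto
    have sq: "(cmod (a j))\<^sup>2 + (cmod (a k))\<^sup>2 = (cmod (c j))\<^sup>2 + (cmod (c k))\<^sup>2"
      using energy k unfolding \<Lambda> by simp
    have jk: "cmod (a j) * cmod (a k) = cmod (c j) * cmod (c k)" using prod j k by metis
    \<comment> \<open>The squared moduli of \<open>a\<close> have the same sum and product as those
      of \<open>c\<close>, so they are roots of the same quadratic polynomial.\<close>
    have "((cmod (a j))\<^sup>2 - (cmod (c j))\<^sup>2) * ((cmod (a j))\<^sup>2 - (cmod (c k))\<^sup>2)
        = (cmod (a j))\<^sup>2 * (cmod (a j))\<^sup>2 - (cmod (a j))\<^sup>2 * ((cmod (c j))\<^sup>2 + (cmod (c k))\<^sup>2) + (cmod (c j) * cmod (c k))\<^sup>2"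
      by (simp add: algebra_simps power2_eq_square)
    also have "\<dots> = 0" unfolding sq[symmetric] jk[symmetric] by (simp add: algebra_simps power2_eq_square)
    finally have aj: "cmod (a j) = cmod (c k)" using j(2) by (simp add: power2_eq_iff_nonneg)
    then have ak: "cmod (a k) = cmod (c j)" using jk pos[OF k(1)] by (simp add: mult.commute)
    have "cmod (a (j + k - i)) = cmod (c i)" if "i \<in> \<Lambda>" for i
      using that aj ak unfolding \<Lambda> by auto
    then obtain \<omega> :: "int \<Rightarrow> real"
      where \<omega>: "\<And>t. pulse_signal \<Lambda> T (\<lambda>i. a (j + k - i)) t = pulse_signal \<Lambda> T (\<lambda>i. cis (\<omega> i) * c i) t"
      using phases_if_moduli_eq[of "\<lambda>i. a (j + k - i)"] by blast
    have "trivial_transform (pulse_signal \<Lambda> T a)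
       (\<lambda>t. cis (0 + 0 * t) * pulse_signal \<Lambda> T a (-1 * t - - (of_int j + of_int k + T)))"
      by (rule trivial_transform_affine) simp
    moreover have "cis (0 + 0 * t) * pulse_signal \<Lambda> T a (-1 * t - - (of_int j + of_int k + T))
       = pulse_signal \<Lambda> T (\<lambda>i. cis (\<omega> i) * c i) t" for t :: real
    proof -
      have eq: "-1 * t - - (of_int j + of_int k + T) = of_int j + of_int k + T - t" by simp
      show ?thesis unfolding eq using \<omega>[of t] pulse_signal_reflect_pair[of j k a t] unfolding \<Lambda> by simp
    qed
    ultimately have "trivial_transform (pulse_signal \<Lambda> T a) (pulse_signal \<Lambda> T (\<lambda>i. cis (\<omega> i) * c i))" by (simp only:)
    then show ?thesis using trivial_transform_sym by blast
  qed
qed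

lemma partner_imp_trivial_transform:
  assumes "partner v"
  shows "\<exists>\<omega>::int \<Rightarrow> real. trivial_transform (pulse_signal \<Lambda> T (\<lambda>j. cis (\<omega> j) * c j)) v"
proof -
  obtain v1 \<alpha> \<alpha>' where v1: "trivial_transform v v1" "normalized v1 \<alpha> \<alpha>'"
    using partner_normalized[OF assms] by blast
  obtain v2 \<beta> \<beta>' where v2: "trivial_transform v1 v2" "normalized v2 \<beta> \<beta>'"
    "AE t in lborel. (\<forall>k\<in>\<Lambda>. t \<notin> block T k) \<longrightarrow> v2 t = 0"
    using normalized_on_blocks[OF v1(2)] by blast
  obtain a where a: "AE t in lborel. v2 t = pulse_signal \<Lambda> T a t"
    using normalized_pulse[OF v2(2,3)] by blast
  have "cmod (ambiguity (pulse_signal \<Lambda> T a) x y) = cmod (ambiguity u x y)" for x y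
    using ambiguity_cong_AE[OF a partnerD(2)[OF normalizedD(1)[OF v2(2)]] pulse_signal_measurable[OF T_less_1], of x y]
      partnerD(3)[OF normalizedD(1)[OF v2(2)], of x y] by simp
  then obtain \<omega> :: "int \<Rightarrow> real"
    where "trivial_transform (pulse_signal \<Lambda> T (\<lambda>j. cis (\<omega> j) * c j)) (pulse_signal \<Lambda> T a)"
    using pulse_coefficients by blast
  moreover have "trivial_transform (pulse_signal \<Lambda> T a) v2" by (rule trivial_transform_AE_eq[OF a])
  moreover have "trivial_transform v2 v"
    using trivial_transform_sym[OF trivial_transform_trans[OF v1(1) v2(1)]] .
  ultimately show ?thesis using trivial_transform_trans by blast
qed

end

text \<open>Discarding indices with coefficient zero changes none of the signals and keeps the
  \<open>B\<^sub>3\<close> property, so the locale applies unless nothing is left.\<close>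

lemma trivial_transform_if_ambiguity_partners_pulse_signal:
  assumes "finite \<Lambda>" "B3_set \<Lambda>" "0 < T" "T \<le> 1 / 2"
    and partners: "ambiguity_partners (pulse_signal \<Lambda> T c) v"
  shows "\<exists>\<omega>::int \<Rightarrow> real. trivial_transform (pulse_signal \<Lambda> T (\<lambda>j. cis (\<omega> j) * c j)) v"
proof -
  have T1: "T < 1" using assms by simp
  define \<Lambda>' where "\<Lambda>' = {j \<in> \<Lambda>. c j \<noteq> 0}"
  have eq: "pulse_signal \<Lambda> T (\<lambda>j. z j * c j) = pulse_signal \<Lambda>' T (\<lambda>j. z j * c j)" for z
    by (auto simp: pulse_signal_eq[OF T1] \<Lambda>'_def)
  have eq1: "pulse_signal \<Lambda> T c = pulse_signal \<Lambda>' T c" using eq[of "\<lambda>_. 1"] by simp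
  show ?thesis
  proof (cases "\<Lambda>' = {}")
    case True
    then have u: "pulse_signal \<Lambda>' T d = (\<lambda>t. 0)" for d by (simp add: pulse_signal_def fun_eq_iff)
    have v: "v \<in> L2" "\<And>x y. ambiguity v x y = 0"
      using partners by (auto simp: ambiguity_partners_def eq1 u ambiguity_def)
    \<comment> \<open>The shift 0 turns the vanishing ambiguity function into the vanishing of the
      squared modulus of \<open>v\<close>.\<close>
    have "AE t in lborel. v t * cnj (v (t - 0)) = 0" using v by (rule AE_product_zero_if_ambiguity_zero)
    then have "AE t in lborel. v t = pulse_signal \<Lambda> T (\<lambda>j. cis 0 * c j) t"
      unfolding eq u by eventually_elim simp
    then show ?thesis by (intro exI[of _ "\<lambda>_. 0"] trivial_transform_AE_eq)
  next
    case False
    interpret B3_pulse \<Lambda>' c T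
      using assms False B3_set_subset[of \<Lambda> \<Lambda>'] by unfold_locales (auto simp: \<Lambda>'_def)
    have "partner v" using partners by (simp add: ambiguity_partners_def partner_def u_def eq1)
    then show ?thesis unfolding eq by (rule partner_imp_trivial_transform)
  qed
qed

theorem theoremD:
  fixes \<Lambda> :: "int set" and c :: "int \<Rightarrow> complex" and T :: real
  assumes "(\<lambda>j. (cmod (c j))\<^sup>2) summable_on \<Lambda>"
    and "0 < T" and "T \<le> 1 / 2"
  shows "(B2_set \<Lambda> \<longrightarrow>
           (\<forall>\<omega> :: int \<Rightarrow> real.
              ambiguity_partners (pulse_signal \<Lambda> T c)
                (pulse_signal \<Lambda> T (\<lambda>j. cis (\<omega> j) * c j))))
       \<and> (finite \<Lambda> \<and> B3_set \<Lambda> \<longrightarrow>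
           (\<forall>v\<in>L2. ambiguity_partners (pulse_signal \<Lambda> T c) v \<longleftrightarrow>
              (\<exists>\<omega> :: int \<Rightarrow> real.
                 trivial_transform (pulse_signal \<Lambda> T (\<lambda>j. cis (\<omega> j) * c j)) v)))"
proof (intro conjI impI allI ballI iffI)
  fix \<omega> :: "int \<Rightarrow> real" assume "B2_set \<Lambda>"
  then show "ambiguity_partners (pulse_signal \<Lambda> T c) (pulse_signal \<Lambda> T (\<lambda>j. cis (\<omega> j) * c j))"
    by (rule ambiguity_partners_pulse_signal_phases[OF assms(2,3,1)])
next
  fix v assume "finite \<Lambda> \<and> B3_set \<Lambda>" "ambiguity_partners (pulse_signal \<Lambda> T c) v"
  then show "\<exists>\<omega>::int \<Rightarrow> real. trivial_transform (pulse_signal \<Lambda> T (\<lambda>j. cis (\<omega> j) * c j)) v"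
    using trivial_transform_if_ambiguity_partners_pulse_signal assms by blast
next
  fix v assume \<Lambda>: "finite \<Lambda> \<and> B3_set \<Lambda>" and v: "v \<in> L2"
    and "\<exists>\<omega>::int \<Rightarrow> real. trivial_transform (pulse_signal \<Lambda> T (\<lambda>j. cis (\<omega> j) * c j)) v"
  then obtain \<omega> :: "int \<Rightarrow> real"
    where tt: "trivial_transform (pulse_signal \<Lambda> T (\<lambda>j. cis (\<omega> j) * c j)) v" by blast
  \<comment> \<open>The converse composes two invariances: phase changes, through
    \<open>B\<^sub>2\<close>, and trivial transforms.\<close>
  have "ambiguity_partners (pulse_signal \<Lambda> T c) (pulse_signal \<Lambda> T (\<lambda>j. cis (\<omega> j) * c j))"
    using \<Lambda> by (intro ambiguity_partners_pulse_signal_phases[OF assms(2,3,1)] B3_set_imp_B2_set) simp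
  then show "ambiguity_partners (pulse_signal \<Lambda> T c) v"
    using cmod_ambiguity_trivial_transform[OF tt _ L2_measurable[OF v]] v
    by (simp add: ambiguity_partners_def L2_measurable)
qed

end
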